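(* Let $d\ge1$ be an integer. For each of the settings (I) and (II) under (A1), there exists an objective function $F$ (on some $d$-dimensional $\Theta$) such that, for any step-size $s>0$, the iterates $(f_k)_{k\ge0}$ of the Proximal Gradient Method (PGM) with distance-generating function $\eta_{\mathrm{ent}}$, initialized with $f_0=1$, satisfy $$F(f_k)-\inf F\asymp k^{-1},$$ i.e. there exist $c,C>0$ independent of $k$ such that $c\,k^{-1}\le F(f_k)-\inf F\le C\,k^{-1}$ for all $k\ge1$.
   Context: $\Theta$ is a compact $d$-dimensional Riemannian manifold without boundary, with geodesic distance $\mathrm{dist}$, and $\tau$ is the probability measure on $\Theta$ proportional to the volume measure. $\mathcal{M}(\Theta)$ (resp. $\mathcal{M}_+(\Theta)$, $\mathcal{P}(\Theta)$) is the set of finite signed (resp. finite nonnegative, probability) Borel measures on $\Theta$, and $\|\mu\|$ is the total variation norm. $\iota_C$ is the convex indicator of $C$. Objective: $\bar F=\bar G+\bar H:\mathcal{M}(\Theta)\to\mathbb{R}\cup\{+\infty\}$ with $\bar G(\mu)=R\big(\int\Phi\,\mathrm{d}\mu\big)$, under (A1): $\Phi\in\mathcal{C}^0(\Theta;\mathcal{F})$ where $\mathcal{F}$ is a Hilbert space; $R:\mathcal{F}\to\mathbb{R}$ is convex and differentiable with Lipschitz gradient $\nabla R$; $\bar H$ is a sum of functions from the list $\iota_{\mathcal{P}(\Theta)}$, $\iota_{\mathcal{M}_+(\Theta)}$, $\mu\mapsto\lambda\|\mu\|$, $\iota_{\{\mu:\lambda\|\mu\|\le1\}}$ (with $\lambda\ge0$).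 For $f\in L^1(\tau)$: $F(f)=\bar F(f\tau)$, $G(f)=\bar G(f\tau)$, $H(f)=\bar H(f\tau)$, and $\inf F=\inf_{L^1(\tau)}F$. The differential of $\bar G$ at $\mu$ is represented by the function $\bar G'[\mu](\theta)=\langle\nabla R(\int\Phi\,\mathrm{d}\mu),\Phi(\theta)\rangle_{\mathcal{F}}$, and $G'[f]=\bar G'[f\tau]$. Settings: in each of them there is $\mu^*\in\mathcal{M}(\Theta)$ with $\bar F(\mu^* )=\inf F$, and (I): $\Phi$ is Lipschitz. (II): $\nabla_\theta\Phi$ is Lipschitz (i.e. $\Phi$ is $\mathcal{C}^1$ with Lipschitz derivative). Shannon entropy: $\eta_{\mathrm{ent}}(u)=u\log u-u+1$ for $u\ge0$ (with $0\log0=0$), and $+\infty$ for $u<0$. PGM with distance-generating function $\eta$ and step-size $s>0$: given $f_0\in\operatorname{dom}H$, for $k=0,1,\dots$ $$f_{k+1}=\arg\min_{f\in L^1(\tau)}\Big\{G(f_k)+\int G'[f_k](f-f_k)\,\mathrm{d}\tau+H(f)+\tfrac1sD_{\bar\eta}(f,f_k)\Big\},$$ where $D_{\bar\eta}(f,g)=\int_\Theta\big(\eta(f)-\eta(g)-\eta'(g)(f-g)\big)\mathrm{d}\tau$. *)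

theory Defs
  imports "HOL-Analysis.Analysis"
begin

section \<open>The Hilbert space of square-summable sequences\<close>

text \<open>
  HOL cannot quantify existentially over types, so the feature space \<open>\<F>\<close> of an objective that is
  claimed to exist is taken to be \<open>\<ell>\<^sup>2\<close>.  This neither loses nor adds an objective: a continuous
  \<open>\<Phi>\<close> on a compact space takes its values in a closed separable subspace \<open>E\<close> of \<open>\<F>\<close>, \<open>E\<close> is isometric
  to a closed subspace of \<open>\<ell>\<^sup>2\<close>, and a function \<open>R\<close> on \<open>E\<close> extends to all of \<open>\<ell>\<^sup>2\<close> by composition with
  the orthogonal projection, which preserves convexity and a Lipschitz gradient.
\<close>

typedef ell2 = "{x :: nat \<Rightarrow> real. summable (\<lambda>n. (x n)\<^sup>2)}"
  morphisms ell2_nth Abs_ell2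
  by (rule exI[of _ "\<lambda>_. 0"]) simp

setup_lifting type_definition_ell2

lemma summable_mult_ell2:
  fixes x y :: "nat \<Rightarrow> real"
  assumes "summable (\<lambda>n. (x n)\<^sup>2)" "summable (\<lambda>n. (y n)\<^sup>2)"
  shows "summable (\<lambda>n. x n * y n)"
proof (rule summable_comparison_test'[OF summable_add[OF assms], of 0])
  fix n
  have "2 * \<bar>x n * y n\<bar> \<le> (x n)\<^sup>2 + (y n)\<^sup>2"
    using sum_squares_bound[of "\<bar>x n\<bar>" "\<bar>y n\<bar>"] by (simp add: abs_mult)
  then show "norm (x n * y n) \<le> (x n)\<^sup>2 + (y n)\<^sup>2"
    unfolding real_norm_def by linarith
qed

lemma summable_add_ell2:
  fixes x y :: "nat \<Rightarrow> real"
  assumes "summable (\<lambda>n. (x n)\<^sup>2)" "summable (\<lambda>n. (y n)\<^sup>2)"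
  shows "summable (\<lambda>n. (x n + y n)\<^sup>2)"
proof -
  have "summable (\<lambda>n. (x n)\<^sup>2 + (y n)\<^sup>2 + 2 * (x n * y n))"
    by (intro summable_add summable_mult assms summable_mult_ell2)
  then show ?thesis by (simp add: power2_sum mult.assoc)
qed

instantiation ell2 :: real_vector
begin

lift_definition zero_ell2 :: ell2 is "\<lambda>_. 0" by simp
lift_definition plus_ell2 :: "ell2 \<Rightarrow> ell2 \<Rightarrow> ell2" is "\<lambda>x y n. x n + y n"
  by (rule summable_add_ell2)
lift_definition uminus_ell2 :: "ell2 \<Rightarrow> ell2" is "\<lambda>x n. - x n" by simp
lift_definition minus_ell2 :: "ell2 \<Rightarrow> ell2 \<Rightarrow> ell2" is "\<lambda>x y n. x n - y n"
  using summable_add_ell2[of _ "\<lambda>n. - _ n"] by simp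
lift_definition scaleR_ell2 :: "real \<Rightarrow> ell2 \<Rightarrow> ell2" is "\<lambda>r x n. r * x n"
  by (simp add: power_mult_distrib summable_mult)

instance
  by standard (transfer; auto simp: algebra_simps)+

end

instantiation ell2 :: real_inner
begin

lift_definition inner_ell2 :: "ell2 \<Rightarrow> ell2 \<Rightarrow> real" is "\<lambda>x y. \<Sum>n. x n * y n" .
definition norm_ell2 :: "ell2 \<Rightarrow> real" where "norm_ell2 x = sqrt (x \<bullet> x)"
definition dist_ell2 :: "ell2 \<Rightarrow> ell2 \<Rightarrow> real" where "dist_ell2 x y = norm (x - y)"
definition sgn_ell2 :: "ell2 \<Rightarrow> ell2" where "sgn_ell2 x = x /\<^sub>R norm x"
definition uniformity_ell2 :: "(ell2 \<times> ell2) filter" where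
  "uniformity_ell2 = (INF e\<in>{0<..}. principal {(x, y). dist x y < e})"
definition open_ell2 :: "ell2 set \<Rightarrow> bool" where
  "open_ell2 U = (\<forall>x\<in>U. eventually (\<lambda>(x', y). x' = x \<longrightarrow> y \<in> U) uniformity)"

instance
proof
  fix x y z :: ell2 and r :: real
  show "dist x y = norm (x - y)" by (rule dist_ell2_def)
  show "sgn x = x /\<^sub>R norm x" by (rule sgn_ell2_def)
  show "uniformity = (INF e\<in>{0<..}. principal {(x::ell2, y). dist x y < e})"
    by (rule uniformity_ell2_def)
  show "open U = (\<forall>x\<in>U. \<forall>\<^sub>F (x', y) in uniformity. x' = x \<longrightarrow> y \<in> U)" for U :: "ell2 set"
    by (rule open_ell2_def)
  show "x \<bullet> y = y \<bullet> x" by transfer (simp add: mult.commute)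
  show "(x + y) \<bullet> z = x \<bullet> z + y \<bullet> z"
    by transfer (simp add: algebra_simps suminf_add summable_mult_ell2)
  show "(r *\<^sub>R x) \<bullet> y = r * (x \<bullet> y)"
    by transfer (simp add: mult.assoc suminf_mult summable_mult_ell2)
  show "0 \<le> x \<bullet> x"
    by transfer (simp add: suminf_nonneg flip: power2_eq_square)
  show "(x \<bullet> x = 0) = (x = 0)"
    by transfer (simp add: suminf_eq_zero_iff fun_eq_iff flip: power2_eq_square)
  show "norm x = sqrt (x \<bullet> x)" by (rule norm_ell2_def)
qed

end

lemma ell2_nth_diff: "ell2_nth (x - y) n = ell2_nth x n - ell2_nth y n"
  by transfer simp

lemma summable_ell2_nth: "summable (\<lambda>n. (ell2_nth x n)\<^sup>2)"
  using ell2_nth[of x] by simp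

lemma norm_ell2_power2: "(norm x)\<^sup>2 = (\<Sum>n. (ell2_nth x n)\<^sup>2)" for x :: ell2
  unfolding power2_norm_eq_inner by transfer (simp add: power2_eq_square)

lemma sum_ell2_nth_le: "(\<Sum>i<N. (ell2_nth x i)\<^sup>2) \<le> (norm x)\<^sup>2"
  unfolding norm_ell2_power2 by (rule sum_le_suminf) (auto simp: summable_ell2_nth)

lemma abs_ell2_nth_le: "\<bar>ell2_nth x n\<bar> \<le> norm x"
proof -
  have "(ell2_nth x n)\<^sup>2 \<le> (\<Sum>i<Suc n. (ell2_nth x i)\<^sup>2)"
    by (simp add: sum_nonneg)
  also have "\<dots> \<le> (norm x)\<^sup>2" by (rule sum_ell2_nth_le)
  finally show ?thesis by (simp add: abs_le_square_iff[symmetric])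
qed

instance ell2 :: complete_space
proof
  fix X :: "nat \<Rightarrow> ell2"
  assume X: "Cauchy X"
  have "convergent (\<lambda>m. ell2_nth (X m) n)" for n
  proof (rule real_Cauchy_convergent, rule metric_CauchyI)
    fix e :: real assume "e > 0"
    then obtain M where M: "\<And>m k. m \<ge> M \<Longrightarrow> k \<ge> M \<Longrightarrow> dist (X m) (X k) < e"
      using X unfolding Cauchy_def by metis
    have "dist (ell2_nth (X m) n) (ell2_nth (X k) n) < e" if "m \<ge> M" "k \<ge> M" for m k
      using M[OF that] abs_ell2_nth_le[of "X m - X k" n]
      by (simp add: dist_norm ell2_nth_diff)
    then show "\<exists>M. \<forall>m\<ge>M. \<forall>k\<ge>M. dist (ell2_nth (X m) n) (ell2_nth (X k) n) < e" by blast
  qed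
  then obtain y where y: "\<And>n. (\<lambda>m. ell2_nth (X m) n) \<longlonglongrightarrow> y n"
    unfolding convergent_def by metis
  have bound: "\<exists>M. \<forall>m\<ge>M. \<forall>N. (\<Sum>i<N. (ell2_nth (X m) i - y i)\<^sup>2) \<le> e\<^sup>2" if "e > 0" for e
  proof -
    obtain M where M: "\<And>m k. m \<ge> M \<Longrightarrow> k \<ge> M \<Longrightarrow> dist (X m) (X k) < e"
      using X \<open>e > 0\<close> unfolding Cauchy_def by metis
    have "(\<Sum>i<N. (ell2_nth (X m) i - y i)\<^sup>2) \<le> e\<^sup>2" if m: "m \<ge> M" for m N
    proof (rule tendsto_upperbound)
      show "(\<lambda>k. \<Sum>i<N. (ell2_nth (X m) i - ell2_nth (X k) i)\<^sup>2)
          \<longlonglongrightarrow> (\<Sum>i<N. (ell2_nth (X m) i - y i)\<^sup>2)"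
        by (intro tendsto_intros y)
      have "(\<Sum>i<N. (ell2_nth (X m) i - ell2_nth (X k) i)\<^sup>2) \<le> e\<^sup>2" if "k \<ge> M" for k
      proof -
        have "(\<Sum>i<N. (ell2_nth (X m) i - ell2_nth (X k) i)\<^sup>2) \<le> (norm (X m - X k))\<^sup>2"
          using sum_ell2_nth_le[of "X m - X k" N] by (simp add: ell2_nth_diff)
        also have "\<dots> \<le> e\<^sup>2"
          using M[OF m that] by (intro power_mono) (auto simp: dist_norm)
        finally show ?thesis .
      qed
      then show "\<forall>\<^sub>F k in sequentially. (\<Sum>i<N. (ell2_nth (X m) i - ell2_nth (X k) i)\<^sup>2) \<le> e\<^sup>2"
        by (auto simp: eventually_sequentially)
    qed simp
    then show ?thesis by blast
  qed
  have summ: "summable (\<lambda>i. (ell2_nth (X m) i - y i)\<^sup>2)"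
    if "\<forall>N. (\<Sum>i<N. (ell2_nth (X m) i - y i)\<^sup>2) \<le> e\<^sup>2" for m e
    using that by (intro summableI_nonneg_bounded[where x = "e\<^sup>2"]) auto
  obtain M where M: "\<forall>N. (\<Sum>i<N. (ell2_nth (X M) i - y i)\<^sup>2) \<le> 1\<^sup>2"
    using bound[of 1] by auto
  have "summable (\<lambda>i. (ell2_nth (X M) i + - (ell2_nth (X M) i - y i))\<^sup>2)"
    using summ[OF M] by (intro summable_add_ell2 summable_ell2_nth) (simp only: power2_minus)
  then have Y: "ell2_nth (Abs_ell2 y) = y"
    by (intro Abs_ell2_inverse) simp
  have "X \<longlonglongrightarrow> Abs_ell2 y"
  proof (rule metric_LIMSEQ_I)
    fix r :: real assume "r > 0"
    then obtain M where M: "\<forall>m\<ge>M. \<forall>N. (\<Sum>i<N. (ell2_nth (X m) i - y i)\<^sup>2) \<le> (r / 2)\<^sup>2"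
      using bound[of "r / 2"] by auto
    have "dist (X m) (Abs_ell2 y) < r" if "m \<ge> M" for m
    proof -
      have "(norm (X m - Abs_ell2 y))\<^sup>2 \<le> (r / 2)\<^sup>2"
        unfolding norm_ell2_power2 ell2_nth_diff Y
        using M that summ by (intro suminf_le_const) blast+
      then have "norm (X m - Abs_ell2 y) \<le> r / 2"
        using \<open>r > 0\<close> by (simp add: power_mono_iff)
      then show ?thesis using \<open>r > 0\<close> by (simp add: dist_norm)
    qed
    then show "\<exists>M. \<forall>m\<ge>M. dist (X m) (Abs_ell2 y) < r" by blast
  qed
  then show "convergent X" unfolding convergent_def by blast
qed

instance ell2 :: banach ..

lemma ell2_approx_finite_rational:
  fixes x :: ell2
  assumes "e > 0"
  shows "\<exists>l :: rat list. dist x (Abs_ell2 (\<lambda>n. if n < length l then of_rat (l ! n) else 0)) < e"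
proof -
  obtain N where N: "norm (\<Sum>i. (ell2_nth x (i + N))\<^sup>2) < e\<^sup>2 / 2"
    using suminf_exist_split[OF _ summable_ell2_nth, of "e\<^sup>2 / 2" x] assms by auto
  define d where "d = e / sqrt (2 * (real N + 1))"
  have "d > 0" using assms by (simp add: d_def)
  have "\<forall>n. \<exists>q. \<bar>ell2_nth x n - of_rat q\<bar> < d"
  proof
    fix n
    obtain q where "ell2_nth x n - d < of_rat q" "of_rat q < ell2_nth x n"
      using of_rat_dense[of "ell2_nth x n - d" "ell2_nth x n"] \<open>d > 0\<close> by auto
    then show "\<exists>q. \<bar>ell2_nth x n - of_rat q\<bar> < d"
      by (intro exI[of _ q]) linarith
  qed
  then obtain q where q: "\<And>n. \<bar>ell2_nth x n - of_rat (q n)\<bar> < d" by metis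
  define l where "l = map q [0..<N]"
  let ?y = "\<lambda>n. if n < length l then of_rat (l ! n) else 0 :: real"
  have "summable (\<lambda>n. (?y n)\<^sup>2)"
    by (rule summable_finite[of "{..<length l}"]) auto
  then have y: "ell2_nth (Abs_ell2 ?y) = ?y"
    by (intro Abs_ell2_inverse) simp
  let ?z = "x - Abs_ell2 ?y"
  have z: "ell2_nth ?z i = ell2_nth x i - (if i < N then of_rat (q i) else 0)" for i
    unfolding ell2_nth_diff y by (simp add: l_def)
  have head: "(\<Sum>i<N. (ell2_nth ?z i)\<^sup>2) \<le> e\<^sup>2 / 2"
  proof -
    have "(\<Sum>i<N. (ell2_nth ?z i)\<^sup>2) \<le> (\<Sum>i<N. d\<^sup>2)"
    proof (rule sum_mono)
      fix i assume "i \<in> {..<N}"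
      then have "\<bar>ell2_nth ?z i\<bar> \<le> d"
        using q[of i] unfolding z by simp
      then show "(ell2_nth ?z i)\<^sup>2 \<le> d\<^sup>2"
        using \<open>d > 0\<close> by (simp add: abs_le_square_iff[symmetric])
    qed
    also have "\<dots> = e\<^sup>2 / 2 * (real N / (real N + 1))"
      by (simp add: d_def power_divide)
    also have "\<dots> \<le> e\<^sup>2 / 2 * 1"
      by (intro mult_left_mono) auto
    finally show ?thesis by simp
  qed
  have "(norm ?z)\<^sup>2 = (\<Sum>i. (ell2_nth ?z (i + N))\<^sup>2) + (\<Sum>i<N. (ell2_nth ?z i)\<^sup>2)"
    unfolding norm_ell2_power2 by (rule suminf_split_initial_segment[OF summable_ell2_nth])
  also have "(\<lambda>i. (ell2_nth ?z (i + N))\<^sup>2) = (\<lambda>i. (ell2_nth x (i + N))\<^sup>2)"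
    by (simp add: z)
  also have "(\<Sum>i. (ell2_nth x (i + N))\<^sup>2) + (\<Sum>i<N. (ell2_nth ?z i)\<^sup>2) < e\<^sup>2"
    using N head by simp
  finally have "norm ?z < e"
    using assms by (simp add: power2_less_imp_less)
  then show ?thesis by (intro exI[of _ l]) (simp add: dist_norm)
qed

instance ell2 :: second_countable_topology
proof
  define D where "D = range (\<lambda>l :: rat list. Abs_ell2 (\<lambda>n. if n < length l then of_rat (l ! n) else 0))"
  define B where "B = (\<lambda>(x, r :: rat). ball x (of_rat r)) ` (D \<times> UNIV)"
  have "countable B" unfolding B_def D_def by auto
  moreover have "topological_basis B"
  proof (rule topological_basisI)
    fix U :: "ell2 set" and x assume "open U" "x \<in> U"
    then obtain e where e: "e > 0" "ball x e \<subseteq> U" by (auto simp: open_contains_ball)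
    obtain r where r: "0 < (of_rat r :: real)" "of_rat r < e / 2"
      using of_rat_dense[of 0 "e / 2"] e(1) by auto
    obtain y where y: "y \<in> D" "dist x y < of_rat r"
      using ell2_approx_finite_rational[of "of_rat r" x] r(1) unfolding D_def by auto
    have "ball y (of_rat r) \<subseteq> ball x e"
    proof
      fix z assume "z \<in> ball y (of_rat r)"
      then show "z \<in> ball x e"
        using y(2) r dist_triangle[of x z y] by simp
    qed
    then have "ball y (of_rat r) \<subseteq> U" using e(2) by blast
    moreover have "x \<in> ball y (of_rat r)" using y(2) by (simp add: dist_commute)
    moreover have "ball y (of_rat r) \<in> B" unfolding B_def using y(1) by force
    ultimately show "\<exists>V\<in>B. x \<in> V \<and> V \<subseteq> U" by blast
  qed (auto simp: B_def)
  ultimately show "\<exists>B :: ell2 set set. countable B \<and> open = generate_topology B"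
    by (auto intro!: exI[of _ B] ext topological_basis_imp_subbasis)
qed


section \<open>Compact Riemannian manifolds\<close>

text \<open>On an open subset of a Euclidean space this is the usual class \<open>C\<^sup>k\<close>.\<close>

primrec Ck_on :: "nat \<Rightarrow> 'a::euclidean_space set \<Rightarrow> ('a \<Rightarrow> 'b::real_normed_vector) \<Rightarrow> bool" where
  "Ck_on 0 S f \<longleftrightarrow> continuous_on S f"
| "Ck_on (Suc k) S f \<longleftrightarrow>
    (\<exists>f'. (\<forall>x\<in>S. (f has_derivative f' x) (at x)) \<and> (\<forall>v. Ck_on k S (\<lambda>x. f' x v)))"

definition smooth_on :: "'a::euclidean_space set \<Rightarrow> ('a \<Rightarrow> 'b::real_normed_vector) \<Rightarrow> bool" where
  "smooth_on S f \<longleftrightarrow> (\<forall>k. Ck_on k S f)"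

text \<open>
  A chart is a pair of its domain and its coordinate map; the metric is given by its coefficient
  matrix in each chart, as a function of the coordinates.  The dimension is \<open>CARD('n)\<close>.
  The type \<open>'a\<close> only provides names for the points, since the topology is part of the structure.  A
  compact connected manifold of dimension at least \<open>1\<close> has the cardinality of the continuum, so
  every such manifold has a copy on any type of that cardinality, for instance \<open>complex ^ 'n\<close>.
\<close>

type_synonym ('a, 'n) chart = "'a set \<times> ('a \<Rightarrow> real ^ 'n)"

record ('a, 'n) riemannian =
  topol :: "'a topology"
  atlas :: "('a, 'n) chart set"
  metric :: "('a, 'n) chart \<Rightarrow> real ^ 'n \<Rightarrow> real ^ 'n ^ 'n"

definition coords :: "('a, 'n) chart \<Rightarrow> (real ^ 'n) set" where
  "coords c = snd c ` fst c"

definition param :: "('a, 'n) chart \<Rightarrow> real ^ 'n \<Rightarrow> 'a" where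
  "param c = inv_into (fst c) (snd c)"

definition transition :: "('a, 'n) chart \<Rightarrow> ('a, 'n) chart \<Rightarrow> real ^ 'n \<Rightarrow> real ^ 'n" where
  "transition c c' = snd c' \<circ> param c"

definition smooth_atlas :: "'a topology \<Rightarrow> ('a, 'n::finite) chart set \<Rightarrow> bool" where
  "smooth_atlas X \<A> \<longleftrightarrow>
    (\<Union>c\<in>\<A>. fst c) = topspace X \<and>
    (\<forall>c\<in>\<A>. openin X (fst c) \<and> open (coords c) \<and>
       homeomorphic_map (subtopology X (fst c)) (top_of_set (coords c)) (snd c)) \<and>
    (\<forall>c\<in>\<A>. \<forall>c'\<in>\<A>. smooth_on (snd c ` (fst c \<inter> fst c')) (transition c c'))"

definition smooth_metric ::
  "('a, 'n::finite) chart set \<Rightarrow> (('a, 'n) chart \<Rightarrow> real ^ 'n \<Rightarrow> real ^ 'n ^ 'n) \<Rightarrow> bool" where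
  "smooth_metric \<A> g \<longleftrightarrow>
    (\<forall>c\<in>\<A>. smooth_on (coords c) (g c) \<and>
       (\<forall>x\<in>coords c. transpose (g c x) = g c x \<and> (\<forall>v. v \<noteq> 0 \<longrightarrow> v \<bullet> (g c x *v v) > 0))) \<and>
    (\<forall>c\<in>\<A>. \<forall>c'\<in>\<A>. \<forall>p\<in>fst c \<inter> fst c'.
       let J = matrix (frechet_derivative (transition c c') (at (snd c p)))
       in g c (snd c p) = transpose J ** g c' (snd c' p) ** J)"

text \<open>
  Charts map onto open subsets of the whole space, so there is no boundary.  Connectedness makes
  the geodesic distance finite.
\<close>

definition compact_riemannian_manifold :: "('a, 'n::finite) riemannian \<Rightarrow> bool" where
  "compact_riemannian_manifold M \<longleftrightarrow>
    topspace (topol M) \<noteq> {} \<and> compact_space (topol M) \<and> Hausdorff_space (topol M) \<and>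
    connected_space (topol M) \<and>
    smooth_atlas (topol M) (atlas M) \<and> smooth_metric (atlas M) (metric M)"

definition piecewise_C1_curve :: "('a, 'n::finite) riemannian \<Rightarrow> (real \<Rightarrow> 'a) \<Rightarrow> bool" where
  "piecewise_C1_curve M \<gamma> \<longleftrightarrow>
    continuous_map (top_of_set {0..1}) (topol M) \<gamma> \<and>
    (\<forall>c\<in>atlas M. \<forall>a b. 0 \<le> a \<and> b \<le> 1 \<and> \<gamma> ` {a..b} \<subseteq> fst c \<longrightarrow>
       (snd c \<circ> \<gamma>) piecewise_C1_differentiable_on {a..b})"

text \<open>By the transformation rule for the metric, the chosen chart is irrelevant.\<close>

definition speed :: "('a, 'n::finite) riemannian \<Rightarrow> (real \<Rightarrow> 'a) \<Rightarrow> real \<Rightarrow> real" where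
  "speed M \<gamma> t =
    (let c = (SOME c. c \<in> atlas M \<and> \<gamma> t \<in> fst c);
         v = vector_derivative (snd c \<circ> \<gamma>) (at t)
     in sqrt (v \<bullet> (metric M c (snd c (\<gamma> t)) *v v)))"

definition curve_length :: "('a, 'n::finite) riemannian \<Rightarrow> (real \<Rightarrow> 'a) \<Rightarrow> ennreal" where
  "curve_length M \<gamma> = (\<integral>\<^sup>+t\<in>{0..1}. ennreal (speed M \<gamma> t) \<partial>lborel)"

definition geodesic_dist :: "('a, 'n::finite) riemannian \<Rightarrow> 'a \<Rightarrow> 'a \<Rightarrow> ennreal" where
  "geodesic_dist M p q =
    (INF \<gamma>\<in>{\<gamma>. piecewise_C1_curve M \<gamma> \<and> \<gamma> 0 = p \<and> \<gamma> 1 = q}. curve_length M \<gamma>)"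

definition borel_of :: "'a topology \<Rightarrow> 'a measure" where
  "borel_of X = sigma (topspace X) {U. openin X U}"

text \<open>These conditions determine \<open>\<nu>\<close> uniquely, because finitely many chart domains cover the space.\<close>

definition riemannian_volume :: "('a, 'n::finite) riemannian \<Rightarrow> 'a measure \<Rightarrow> bool" where
  "riemannian_volume M \<nu> \<longleftrightarrow>
    space \<nu> = topspace (topol M) \<and> sets \<nu> = sets (borel_of (topol M)) \<and>
    (\<forall>c\<in>atlas M. \<forall>A\<in>sets \<nu>. A \<subseteq> fst c \<longrightarrow>
       emeasure \<nu> A = (\<integral>\<^sup>+x\<in>snd c ` A. ennreal (sqrt (det (metric M c x))) \<partial>lborel))"

definition normalized :: "'a measure \<Rightarrow> 'a measure" where
  "normalized \<nu> = scale_measure (1 / emeasure \<nu> (space \<nu>)) \<nu>"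


section \<open>Finite signed Borel measures\<close>

text \<open>
  A finite signed measure is a real set function, of which only the values on Borel sets matter.
\<close>

definition signed_measures :: "'a topology \<Rightarrow> ('a set \<Rightarrow> real) set" where
  "signed_measures X =
    {\<mu>. \<mu> {} = 0 \<and>
        (\<forall>A::nat \<Rightarrow> 'a set. range A \<subseteq> sets (borel_of X) \<longrightarrow> disjoint_family A \<longrightarrow>
           (\<lambda>i. \<mu> (A i)) sums \<mu> (\<Union>i. A i))}"

definition nonneg_measures :: "'a topology \<Rightarrow> ('a set \<Rightarrow> real) set" where
  "nonneg_measures X = {\<mu> \<in> signed_measures X. \<forall>A\<in>sets (borel_of X). 0 \<le> \<mu> A}"

definition probability_measures :: "'a topology \<Rightarrow> ('a set \<Rightarrow> real) set" where
  "probability_measures X = {\<mu> \<in> nonneg_measures X. \<mu> (topspace X) = 1}"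

text \<open>
  The positive part of the Jordan decomposition, \<open>\<mu>\<^sup>+(A) = sup {\<mu>(B) | B \<subseteq> A}\<close>; the function
  \<open>ennreal\<close> truncates negative values to \<open>0 = \<mu>({})\<close>.
\<close>

definition pos_part :: "'a topology \<Rightarrow> ('a set \<Rightarrow> real) \<Rightarrow> 'a measure" where
  "pos_part X \<mu> =
    measure_of (topspace X) (sets (borel_of X))
      (\<lambda>A. SUP B\<in>{B \<in> sets (borel_of X). B \<subseteq> A}. ennreal (\<mu> B))"

definition neg_part :: "'a topology \<Rightarrow> ('a set \<Rightarrow> real) \<Rightarrow> 'a measure" where
  "neg_part X \<mu> = pos_part X (\<lambda>A. - \<mu> A)"

definition signed_integral ::
  "'a topology \<Rightarrow> ('a set \<Rightarrow> real) \<Rightarrow> ('a \<Rightarrow> 'f::{banach, second_countable_topology}) \<Rightarrow> 'f" where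
  "signed_integral X \<mu> \<Phi> = integral\<^sup>L (pos_part X \<mu>) \<Phi> - integral\<^sup>L (neg_part X \<mu>) \<Phi>"

definition tv_norm :: "'a topology \<Rightarrow> ('a set \<Rightarrow> real) \<Rightarrow> real" where
  "tv_norm X \<mu> = measure (pos_part X \<mu>) (topspace X) + measure (neg_part X \<mu>) (topspace X)"

text \<open>The measure \<open>f\<tau>\<close> with density \<open>f\<close>.\<close>

definition signed_density :: "'a measure \<Rightarrow> ('a \<Rightarrow> real) \<Rightarrow> 'a set \<Rightarrow> real" where
  "signed_density \<tau> f = (\<lambda>A. \<integral>\<theta>\<in>A. f \<theta> \<partial>\<tau>)"


section \<open>Objective functions\<close>

definition convex_indicator :: "'b set \<Rightarrow> 'b \<Rightarrow> ereal" where
  "convex_indicator C x = (if x \<in> C then 0 else \<infinity>)"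

datatype regularizer = Prob_Indicator | Nonneg_Indicator | TV_Penalty real | TV_Ball real

fun reg_value :: "'a topology \<Rightarrow> regularizer \<Rightarrow> ('a set \<Rightarrow> real) \<Rightarrow> ereal" where
  "reg_value X Prob_Indicator \<mu> = convex_indicator (probability_measures X) \<mu>"
| "reg_value X Nonneg_Indicator \<mu> = convex_indicator (nonneg_measures X) \<mu>"
| "reg_value X (TV_Penalty l) \<mu> = ereal (l * tv_norm X \<mu>)"
| "reg_value X (TV_Ball l) \<mu> = convex_indicator {\<mu>. l * tv_norm X \<mu> \<le> 1} \<mu>"

fun reg_weight :: "regularizer \<Rightarrow> real" where
  "reg_weight (TV_Penalty l) = l"
| "reg_weight (TV_Ball l) = l"
| "reg_weight _ = 0"

record ('a, 'f) objective =
  feature :: "'a \<Rightarrow> 'f"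
  loss :: "'f \<Rightarrow> real"
  regs :: "regularizer list"

definition gradient :: "('f::real_inner \<Rightarrow> real) \<Rightarrow> 'f \<Rightarrow> 'f" where
  "gradient R x = (THE g. GDERIV R x :> g)"

definition assumption_A1 ::
  "('a, 'n::finite) riemannian \<Rightarrow> ('a, 'f::real_inner) objective \<Rightarrow> bool" where
  "assumption_A1 M P \<longleftrightarrow>
    continuous_map (topol M) euclidean (feature P) \<and>
    convex_on UNIV (loss P) \<and>
    (\<forall>x. \<exists>g. GDERIV (loss P) x :> g) \<and>
    (\<exists>L. L-lipschitz_on UNIV (gradient (loss P))) \<and>
    (\<forall>h\<in>set (regs P). 0 \<le> reg_weight h)"

text \<open>Functionals on \<open>\<M>(\<Theta>)\<close>, and after that their restrictions to \<open>L\<^sup>1(\<tau>)\<close>.\<close>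

definition G_bar ::
  "'a topology \<Rightarrow> ('a, 'f::{banach, second_countable_topology}) objective \<Rightarrow> ('a set \<Rightarrow> real) \<Rightarrow> real"
  where "G_bar X P \<mu> = loss P (signed_integral X \<mu> (feature P))"

definition H_bar :: "'a topology \<Rightarrow> ('a, 'f) objective \<Rightarrow> ('a set \<Rightarrow> real) \<Rightarrow> ereal" where
  "H_bar X P \<mu> = (\<Sum>h\<leftarrow>regs P. reg_value X h \<mu>)"

definition F_bar ::
  "'a topology \<Rightarrow> ('a, 'f::{banach, second_countable_topology}) objective \<Rightarrow> ('a set \<Rightarrow> real) \<Rightarrow> ereal"
  where "F_bar X P \<mu> = ereal (G_bar X P \<mu>) + H_bar X P \<mu>"

definition G_bar_diff ::
  "'a topology \<Rightarrow> ('a, 'f::{real_inner, banach, second_countable_topology}) objective \<Rightarrow>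
    ('a set \<Rightarrow> real) \<Rightarrow> 'a \<Rightarrow> real" where
  "G_bar_diff X P \<mu> \<theta> = gradient (loss P) (signed_integral X \<mu> (feature P)) \<bullet> feature P \<theta>"

abbreviation L1 :: "'a measure \<Rightarrow> ('a \<Rightarrow> real) set" where
  "L1 \<tau> \<equiv> {f. integrable \<tau> f}"

definition G_dens ::
  "'a topology \<Rightarrow> 'a measure \<Rightarrow> ('a, 'f::{banach, second_countable_topology}) objective \<Rightarrow>
    ('a \<Rightarrow> real) \<Rightarrow> real" where
  "G_dens X \<tau> P f = G_bar X P (signed_density \<tau> f)"

definition G_dens_diff ::
  "'a topology \<Rightarrow> 'a measure \<Rightarrow>
    ('a, 'f::{real_inner, banach, second_countable_topology}) objective \<Rightarrow>
    ('a \<Rightarrow> real) \<Rightarrow> 'a \<Rightarrow> real" where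
  "G_dens_diff X \<tau> P f = G_bar_diff X P (signed_density \<tau> f)"

definition H_dens ::
  "'a topology \<Rightarrow> 'a measure \<Rightarrow> ('a, 'f) objective \<Rightarrow> ('a \<Rightarrow> real) \<Rightarrow> ereal" where
  "H_dens X \<tau> P f = H_bar X P (signed_density \<tau> f)"

definition F_dens ::
  "'a topology \<Rightarrow> 'a measure \<Rightarrow> ('a, 'f::{banach, second_countable_topology}) objective \<Rightarrow>
    ('a \<Rightarrow> real) \<Rightarrow> ereal" where
  "F_dens X \<tau> P f = F_bar X P (signed_density \<tau> f)"

definition inf_F ::
  "'a topology \<Rightarrow> 'a measure \<Rightarrow> ('a, 'f::{banach, second_countable_topology}) objective \<Rightarrow> ereal"
  where "inf_F X \<tau> P = (INF f\<in>L1 \<tau>. F_dens X \<tau> P f)"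


section \<open>Settings (I) and (II)\<close>

definition has_minimizer ::
  "'a topology \<Rightarrow> 'a measure \<Rightarrow> ('a, 'f::{banach, second_countable_topology}) objective \<Rightarrow> bool"
  where "has_minimizer X \<tau> P \<longleftrightarrow> (\<exists>\<mu>\<in>signed_measures X. F_bar X P \<mu> = inf_F X \<tau> P)"

definition lipschitz_map ::
  "('a, 'n::finite) riemannian \<Rightarrow> ('a \<Rightarrow> 'f::metric_space) \<Rightarrow> bool" where
  "lipschitz_map M \<Phi> \<longleftrightarrow>
    (\<exists>L::real. 0 \<le> L \<and>
       (\<forall>p\<in>topspace (topol M). \<forall>q\<in>topspace (topol M).
          ennreal (dist (\<Phi> p) (\<Phi> q)) \<le> ennreal L * geodesic_dist M p q))"

text \<open>
  The derivative of a map on a manifold is Lipschitz if it is locally Lipschitz in coordinates.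
  On a compact manifold this does not depend on the atlas, and it agrees with a global Lipschitz
  condition in which derivatives at different points are compared by parallel transport.
\<close>

definition lipschitz_derivative_map ::
  "('a, 'n::finite) riemannian \<Rightarrow> ('a \<Rightarrow> 'f::real_normed_vector) \<Rightarrow> bool" where
  "lipschitz_derivative_map M \<Phi> \<longleftrightarrow>
    (\<forall>c\<in>atlas M. \<exists>D :: real ^ 'n \<Rightarrow> ((real ^ 'n) \<Rightarrow>\<^sub>L 'f).
       \<forall>x\<in>coords c.
         ((\<Phi> \<circ> param c) has_derivative blinfun_apply (D x)) (at x) \<and>
         (\<exists>e>0. \<exists>L. L-lipschitz_on (ball x e \<inter> coords c) D))"

definition setting_I ::
  "('a, 'n::finite) riemannian \<Rightarrow> 'a measure \<Rightarrow>
    ('a, 'f::{banach, second_countable_topology}) objective \<Rightarrow> bool" where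
  "setting_I M \<tau> P \<longleftrightarrow> has_minimizer (topol M) \<tau> P \<and> lipschitz_map M (feature P)"

definition setting_II ::
  "('a, 'n::finite) riemannian \<Rightarrow> 'a measure \<Rightarrow>
    ('a, 'f::{banach, second_countable_topology}) objective \<Rightarrow> bool" where
  "setting_II M \<tau> P \<longleftrightarrow> has_minimizer (topol M) \<tau> P \<and> lipschitz_derivative_map M (feature P)"


section \<open>The proximal gradient method\<close>

definition entropy :: "real \<Rightarrow> ereal" where
  "entropy u = (if u < 0 then \<infinity> else if u = 0 then 1 else ereal (u * ln u - u + 1))"

text \<open>
  At \<open>0\<close> the derivative is the one-sided one, \<open>-\<infinity>\<close>.  As \<open>\<infinity> * 0 = 0\<close> in \<open>ereal\<close>, the integrand of
  the Bregman divergence below is then \<open>0\<close> where \<open>f = g = 0\<close>, and \<open>\<infinity>\<close> where \<open>f > 0 = g\<close>.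
\<close>

definition entropy_deriv :: "real \<Rightarrow> ereal" where
  "entropy_deriv u = (if u \<le> 0 then -\<infinity> else ereal (ln u))"

lemma entropy_has_derivative:
  assumes "u > 0"
  shows "((\<lambda>v. real_of_ereal (entropy v)) has_real_derivative real_of_ereal (entropy_deriv u)) (at u)"
proof -
  have "((\<lambda>v. v * ln v - v + 1) has_real_derivative ln u) (at u)"
    using assms by (auto intro!: derivative_eq_intros)
  moreover have "\<forall>\<^sub>F v in nhds u. real_of_ereal (entropy v) = v * ln v - v + 1"
    using assms by (intro eventually_mono[OF order_tendstoD(1)[OF filterlim_ident assms]])
      (auto simp: entropy_def)
  ultimately show ?thesis
    using assms by (simp add: entropy_deriv_def DERIV_cong_ev)
qed

text \<open>The integrand is nonnegative by convexity of \<open>\<eta>\<close>, so \<open>e2ennreal\<close> does not truncate it.\<close>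

definition bregman_div ::
  "(real \<Rightarrow> ereal) \<Rightarrow> (real \<Rightarrow> ereal) \<Rightarrow> 'a measure \<Rightarrow> ('a \<Rightarrow> real) \<Rightarrow> ('a \<Rightarrow> real) \<Rightarrow> ereal" where
  "bregman_div \<eta> \<eta>' \<tau> f g =
    enn2ereal (\<integral>\<^sup>+\<theta>. e2ennreal (\<eta> (f \<theta>) - \<eta> (g \<theta>) - \<eta>' (g \<theta>) * ereal (f \<theta> - g \<theta>)) \<partial>\<tau>)"

definition pgm_step_objective ::
  "'a topology \<Rightarrow> 'a measure \<Rightarrow>
    ('a, 'f::{real_inner, banach, second_countable_topology}) objective \<Rightarrow>
    (real \<Rightarrow> ereal) \<Rightarrow> (real \<Rightarrow> ereal) \<Rightarrow> real \<Rightarrow> ('a \<Rightarrow> real) \<Rightarrow> ('a \<Rightarrow> real) \<Rightarrow> ereal" where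
  "pgm_step_objective X \<tau> P \<eta> \<eta>' s g f =
    ereal (G_dens X \<tau> P g + (\<integral>\<theta>. G_dens_diff X \<tau> P g \<theta> * (f \<theta> - g \<theta>) \<partial>\<tau>)) +
    H_dens X \<tau> P f + ereal (1 / s) * bregman_div \<eta> \<eta>' \<tau> f g"

text \<open>Elements of \<open>L\<^sup>1(\<tau>)\<close> are represented by functions, so iterates are determined up to null sets.\<close>

definition pgm_iterates ::
  "'a topology \<Rightarrow> 'a measure \<Rightarrow>
    ('a, 'f::{real_inner, banach, second_countable_topology}) objective \<Rightarrow>
    (real \<Rightarrow> ereal) \<Rightarrow> (real \<Rightarrow> ereal) \<Rightarrow> real \<Rightarrow> ('a \<Rightarrow> real) \<Rightarrow> (nat \<Rightarrow> 'a \<Rightarrow> real) \<Rightarrow> bool" where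
  "pgm_iterates X \<tau> P \<eta> \<eta>' s f0 f \<longleftrightarrow>
    f0 \<in> L1 \<tau> \<and> H_dens X \<tau> P f0 < \<infinity> \<and> f 0 = f0 \<and>
    (\<forall>k. is_arg_min (pgm_step_objective X \<tau> P \<eta> \<eta>' s (f k)) (\<lambda>h. h \<in> L1 \<tau>) (f (Suc k)))"

end

theory Submission
  imports Defs "HOL-Probability.Giry_Monad"
begin

text \<open>
  On a probability space, let \<open>F(\<mu>) = \<integral> \<phi> d\<mu>\<close> on probability measures, with \<open>\<phi> \<ge> 0\<close> vanishing at a
  point, so that a Dirac measure is a minimizer and \<open>inf F = 0\<close>.  Completing the Bregman divergence
  shows that the iterates are the Gibbs densities \<open>exp (- s k \<phi>) / Z(s k)\<close>, where
  \<open>Z(t) = \<integral> exp (- t \<phi>) d\<tau>\<close>; hence \<open>F(f\<^sub>k)\<close> is the mean of \<open>\<phi>\<close> under the Gibbs measure at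
  \<open>t = s k\<close>.  As \<open>x \<le> 2 (exp (x / 2) - 1)\<close> and \<open>1 - exp (- 3 x) \<le> 3 x\<close>, this mean is of order \<open>1 / t\<close>
  as soon as \<open>Z(t / 2) \<le> K Z(t)\<close>, and \<open>Z(4 t) \<le> 3/4 Z(t)\<close> for \<open>t \<ge> 1\<close>.  On the flat torus \<open>\<real>\<^sup>n / \<int>\<^sup>n\<close> with
  \<open>\<phi>(x) = \<Sum>\<^sub>i (1 - cos (2 \<pi> x\<^sub>i))\<close> both estimates follow by the substitution \<open>x \<mapsto> x / 2\<close>, because
  \<open>\<phi>(x) / 4 \<le> \<phi>(x / 2) \<le> \<phi>(x) / 2\<close> on the unit cell.
\<close>

section \<open>Measures with densities\<close>

text \<open>The torus potential is nondegenerate at its minimum: near \<open>0\<close> it behaves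
  like \<open>2 pi^2 |x|^2\<close>, so the Gibbs measure at time \<open>t\<close> resembles a
  Gaussian with variance of order \<open>1 / t\<close>, and \<open>Z(t)\<close> decays like
  \<open>t\<close> to the power \<open>- n / 2\<close>. The mean is \<open>- Z'(t) / Z(t)\<close>,
  and polynomial decay puts it at order \<open>1 / t\<close> in every dimension; comparing
  \<open>Z\<close> at times in a fixed ratio captures this decay without any asymptotics. One smooth
  potential serves both settings. The torus is convenient because its transition maps are local
  translations, so the metric is constant, and because halving maps a fundamental cell into itself.
  Three points shape the rest. Iterates are determined up to null sets, so they are identified
  almost everywhere. The infimum ranges over densities while the minimizer is a Dirac measure, so
  its value 0 has to come out of the upper rate itself. The step size is arbitrary, so the finitely
  many \<open>k\<close> with \<open>s k < 1\<close> fall outside the lower estimate and get a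
  separate bound.\<close>

lemma space_borel_of [simp]: "space (borel_of X) = topspace X"
  unfolding borel_of_def by (rule space_measure_of) (auto dest: openin_subset)

lemma sets_borel_of: "sets (borel_of X) = sigma_sets (topspace X) {U. openin X U}"
  unfolding borel_of_def by (rule sets_measure_of) (auto dest: openin_subset)

lemma openin_sets_borel_of: "openin X U \<Longrightarrow> U \<in> sets (borel_of X)"
  by (simp add: sets_borel_of)

lemma measurable_borel_of:
  assumes "continuous_map X euclidean f"
  shows "f \<in> borel_measurable (borel_of X)"
proof (rule borel_measurableI)
  fix S :: "'b set" assume "open S"
  then have "openin X {x \<in> topspace X. f x \<in> S}"
    using assms by (intro openin_continuous_map_preimage) auto
  moreover have "f -` S \<inter> space (borel_of X) = {x \<in> topspace X. f x \<in> S}" by auto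
  ultimately show "f -` S \<inter> space (borel_of X) \<in> sets (borel_of X)"
    by (simp add: openin_sets_borel_of)
qed

text \<open>Agreement is asked on measurable sets only, since \<open>signed_density\<close> is
  meaningful on those alone.\<close>

lemma finite_measure_in_nonneg_measures:
  assumes "finite_measure N" and sets: "sets N = sets (borel_of X)"
    and \<mu>: "\<And>A. A \<in> sets N \<Longrightarrow> \<mu> A = measure N A"
  shows "\<mu> \<in> nonneg_measures X"
proof -
  interpret finite_measure N by fact
  have "(\<lambda>i. \<mu> (A i)) sums \<mu> (\<Union>i. A i)"
    if "range A \<subseteq> sets (borel_of X)" "disjoint_family A" for A :: "nat \<Rightarrow> 'a set"
  proof -
    have A: "range A \<subseteq> sets N" using that by (simp add: sets)
    then have "\<And>i. \<mu> (A i) = measure N (A i)" "\<mu> (\<Union>i. A i) = measure N (\<Union>i. A i)"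
      by (auto intro!: \<mu>)
    then show ?thesis using finite_measure_UNION[OF A that(2)] by simp
  qed
  moreover have "\<mu> {} = 0" using \<mu>[of "{}"] by simp
  ultimately show ?thesis
    by (auto simp: nonneg_measures_def signed_measures_def \<mu> sets)
qed

text \<open>A measure is monotone, so the supremum over subsets of \<open>A\<close> is attained at
  \<open>A\<close> itself.\<close>

lemma pos_part_finite_measure:
  assumes "finite_measure N" and sets: "sets N = sets (borel_of X)"
    and \<mu>: "\<And>A. A \<in> sets N \<Longrightarrow> \<mu> A = measure N A"
  shows "pos_part X \<mu> = N"
proof -
  interpret finite_measure N by fact
  have space: "space N = topspace X"
    using sets_eq_imp_space_eq[OF sets] by simp
  have "(SUP B\<in>{B \<in> sets N. B \<subseteq> A}. ennreal (\<mu> B)) = emeasure N A" if "A \<in> sets N" for A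
    using that
    by (intro antisym SUP_least SUP_upper2[of A]) (auto simp: \<mu> emeasure_eq_measure finite_measure_mono)
  then have "pos_part X \<mu> = measure_of (space N) (sets N) (emeasure N)"
    unfolding pos_part_def sets[symmetric] space[symmetric]
    by (intro measure_of_eq) (auto simp: sets.space_closed sets.sigma_sets_eq)
  then show ?thesis by (simp add: measure_of_of_measure)
qed

text \<open>The values \<open>- \<mu> B\<close> are nonpositive, so the truncation by
  \<open>ennreal\<close> turns the whole supremum into 0.\<close>

lemma neg_part_finite_measure:
  assumes "finite_measure N" and sets: "sets N = sets (borel_of X)"
    and \<mu>: "\<And>A. A \<in> sets N \<Longrightarrow> \<mu> A = measure N A"
  shows "neg_part X \<mu> = null_measure N"
proof -
  interpret finite_measure N by fact
  have space: "space N = topspace X"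
    using sets_eq_imp_space_eq[OF sets] by simp
  have "(SUP B\<in>{B \<in> sets N. B \<subseteq> A}. ennreal (- \<mu> B)) = emeasure (null_measure N) A"
    if "A \<in> sets N" for A
    using that by (intro antisym SUP_least) (auto simp: \<mu> ennreal_neg)
  then have "neg_part X \<mu> = measure_of (space N) (sets N) (emeasure (null_measure N))"
    unfolding neg_part_def pos_part_def sets[symmetric] space[symmetric]
    by (intro measure_of_eq) (auto simp: sets.space_closed sets.sigma_sets_eq)
  then show ?thesis using measure_of_of_measure[of "null_measure N"] by simp
qed

lemma signed_integral_finite_measure:
  assumes "finite_measure N" "sets N = sets (borel_of X)"
    and "\<And>A. A \<in> sets N \<Longrightarrow> \<mu> A = measure N A"
  shows "signed_integral X \<mu> \<Phi> = integral\<^sup>L N \<Phi>"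
proof -
  have "pos_part X \<mu> = N" "neg_part X \<mu> = null_measure N"
    using assms by (auto intro!: pos_part_finite_measure neg_part_finite_measure)
  then show ?thesis by (simp add: signed_integral_def integral_null_measure)
qed

lemma signed_density_nonneg_eq_measure:
  assumes "integrable \<tau> f" "AE \<theta> in \<tau>. 0 \<le> f \<theta>"
  shows "finite_measure (density \<tau> f)"
    and "A \<in> sets \<tau> \<Longrightarrow> signed_density \<tau> f A = measure (density \<tau> f) A"
proof -
  have eq: "emeasure (density \<tau> f) A = ennreal (\<integral>\<theta>\<in>A. f \<theta> \<partial>\<tau>)" if "A \<in> sets \<tau>" for A
  proof -
    have "emeasure (density \<tau> f) A = (\<integral>\<^sup>+\<theta>. ennreal (indicator A \<theta> * f \<theta>) \<partial>\<tau>)"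
      using assms that
      by (subst emeasure_density) (auto intro!: nn_integral_cong split: split_indicator)
    also have "\<dots> = ennreal (\<integral>\<theta>. indicator A \<theta> * f \<theta> \<partial>\<tau>)"
      using assms that
      by (intro nn_integral_eq_integral integrable_mult_indicator[of A \<tau> f, simplified])
        (auto split: split_indicator)
    finally show ?thesis by (simp add: set_lebesgue_integral_def)
  qed
  show "finite_measure (density \<tau> f)"
    using eq[of "space \<tau>"] by (intro finite_measureI) simp
  show "signed_density \<tau> f A = measure (density \<tau> f) A" if "A \<in> sets \<tau>"
  proof -
    have "0 \<le> (\<integral>\<theta>\<in>A. f \<theta> \<partial>\<tau>)"
      unfolding set_lebesgue_integral_def using assms(2)
      by (intro integral_nonneg_AE) (auto split: split_indicator)
    then show ?thesis
      unfolding signed_density_def measure_def eq[OF that] by simp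
  qed
qed

text \<open>Tested on the set where \<open>f\<close> is negative, the hypothesis forces the integral
  of \<open>- f\<close> over it to vanish, and a nonnegative function with vanishing integral is
  zero almost everywhere.\<close>

lemma AE_nonneg_if_signed_density_nonneg:
  assumes f: "integrable \<tau> f" and "\<And>A. A \<in> sets \<tau> \<Longrightarrow> 0 \<le> signed_density \<tau> f A"
  shows "AE \<theta> in \<tau>. 0 \<le> f \<theta>"
proof -
  let ?A = "{\<theta> \<in> space \<tau>. f \<theta> < 0}"
  have A: "?A \<in> sets \<tau>" using f by measurable
  let ?g = "\<lambda>\<theta>. - (indicator ?A \<theta> * f \<theta>)"
  have int: "integrable \<tau> ?g"
    using integrable_mult_indicator[OF A f] by simp
  have "0 \<le> (\<integral>\<theta>. ?g \<theta> \<partial>\<tau>)"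
    by (intro integral_nonneg_AE) (auto split: split_indicator)
  moreover have "(\<integral>\<theta>. ?g \<theta> \<partial>\<tau>) \<le> 0"
    using assms(2)[OF A] by (simp add: signed_density_def set_lebesgue_integral_def)
  ultimately have "AE \<theta> in \<tau>. ?g \<theta> = 0"
    using integral_nonneg_eq_0_iff_AE[OF int] by (auto split: split_indicator)
  then show ?thesis
    by (rule AE_mp) (auto intro!: AE_I2 split: split_indicator)
qed

text \<open>Splits a sign-changing integrable term off an integral that may be infinite. If
  \<open>v\<close> is not integrable then neither is \<open>u\<close>, and both sides are infinite.
  The sum is formed in the extended reals because the integral of \<open>r\<close> may be
  negative.\<close>

lemma nn_integral_add_integrable:
  assumes u: "u \<in> borel_measurable M" "AE x in M. 0 \<le> u x"
    and v: "v \<in> borel_measurable M" "AE x in M. 0 \<le> v x"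
    and r: "integrable M r" and eq: "AE x in M. u x = v x + r x"
  shows "enn2ereal (\<integral>\<^sup>+x. ennreal (u x) \<partial>M) = enn2ereal (\<integral>\<^sup>+x. ennreal (v x) \<partial>M) + ereal (\<integral>x. r x \<partial>M)"
proof (cases "integrable M v")
  case True
  have "integrable M u \<longleftrightarrow> integrable M (\<lambda>x. v x + r x)"
    using u v r eq True by (intro integrable_cong_AE) auto
  then have iu: "integrable M u" using True r by simp
  have "(\<integral>x. u x \<partial>M) = (\<integral>x. v x + r x \<partial>M)"
    using u v r eq by (intro integral_cong_AE) auto
  moreover have "0 \<le> (\<integral>x. u x \<partial>M)" "0 \<le> (\<integral>x. v x \<partial>M)"
    using u v by (auto intro: integral_nonneg_AE)
  ultimately show ?thesis
    using True r u v iu by (simp add: nn_integral_eq_integral enn2ereal_ennreal)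
next
  case False
  have "\<not> integrable M u"
  proof
    assume "integrable M u"
    then have "integrable M (\<lambda>x. u x - r x)" using r by simp
    moreover have "integrable M (\<lambda>x. u x - r x) \<longleftrightarrow> integrable M v"
      using u v r eq by (intro integrable_cong_AE) auto
    ultimately show False using False by simp
  qed
  then have "(\<integral>\<^sup>+x. ennreal (u x) \<partial>M) = top"
    using integrableI_nonneg[OF u] by (metis infinity_ennreal_def less_top)
  moreover have "(\<integral>\<^sup>+x. ennreal (v x) \<partial>M) = top"
    using False integrableI_nonneg[OF v] by (metis infinity_ennreal_def less_top)
  ultimately show ?thesis by simp
qed

section \<open>Linear objectives on probability measures\<close>

text \<open>The integrand of the generalized Kullback-Leibler divergence. Keeping
  \<open>ln u\<close> and \<open>ln v\<close> apart makes the dependence on \<open>ln v\<close>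
  affine and gives the correct value \<open>v\<close> at \<open>u = 0\<close>.\<close>

definition kl_integrand :: "real \<Rightarrow> real \<Rightarrow> real" where
  "kl_integrand u v = u * ln u - u * ln v - u + v"

lemma entropy_bregman_integrand:
  assumes "0 \<le> u" "0 < v"
  shows "entropy u - entropy v - entropy_deriv v * ereal (u - v) = ereal (kl_integrand u v)"
  using assms by (auto simp: entropy_def entropy_deriv_def kl_integrand_def algebra_simps one_ereal_def)

text \<open>This is \<open>ln x \<le> x - 1\<close> at \<open>x = v / u\<close>, multiplied by
  \<open>u\<close>.\<close>

lemma kl_integrand_nonneg:
  assumes "0 \<le> u" "0 < v"
  shows "0 \<le> kl_integrand u v"
proof (cases "u = 0")
  case False
  then have u: "0 < u" using assms by simp
  have "u * ln (v / u) \<le> u * (v / u - 1)"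
    using u assms by (intro mult_left_mono ln_le_minus_one) auto
  then show ?thesis
    using u assms by (simp add: kl_integrand_def ln_div algebra_simps)
qed (use assms in \<open>simp add: kl_integrand_def\<close>)

text \<open>The equality case of \<open>ln x \<le> x - 1\<close>; it makes the solution of a
  proximal step unique up to null sets.\<close>

lemma kl_integrand_eq_0_iff:
  assumes "0 \<le> u" "0 < v"
  shows "kl_integrand u v = 0 \<longleftrightarrow> u = v"
proof
  assume eq: "kl_integrand u v = 0"
  then have u: "0 < u" using assms by (cases "u = 0") (auto simp: kl_integrand_def)
  have "ln (v / u) = v / u - 1"
    using eq u assms by (simp add: kl_integrand_def ln_div field_simps)
  then have "v / u = 1" using u assms by (intro ln_eq_minus_one) auto
  then show "u = v" using u by simp
qed (simp add: kl_integrand_def)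

lemma bregman_div_entropy:
  assumes "AE \<theta> in \<tau>. 0 \<le> f \<theta>" "AE \<theta> in \<tau>. 0 < g \<theta>"
  shows "bregman_div entropy entropy_deriv \<tau> f g
    = enn2ereal (\<integral>\<^sup>+\<theta>. ennreal (kl_integrand (f \<theta>) (g \<theta>)) \<partial>\<tau>)"
proof -
  have "AE \<theta> in \<tau>. e2ennreal (entropy (f \<theta>) - entropy (g \<theta>) - entropy_deriv (g \<theta>) * ereal (f \<theta> - g \<theta>))
      = ennreal (kl_integrand (f \<theta>) (g \<theta>))"
    using assms by eventually_elim (simp add: entropy_bregman_integrand)
  then show ?thesis
    unfolding bregman_div_def by (intro arg_cong[where f = enn2ereal] nn_integral_cong_AE)
qed

text \<open>\<open>B\<close> supplies the boundedness that compactness of \<open>X\<close> would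
  give, and \<open>e\<close> embeds the real line isometrically in the feature space.\<close>

locale linear_problem = prob_space \<tau> for X :: "'a topology" and \<tau> :: "'a measure" +
  fixes \<phi> :: "'a \<Rightarrow> real" and B :: real and e :: "'f::{real_inner, banach, second_countable_topology}"
  assumes sets_\<tau>: "sets \<tau> = sets (borel_of X)"
    and \<phi>_cont: "continuous_map X euclidean \<phi>"
    and \<phi>_bounds: "\<And>\<theta>. \<theta> \<in> topspace X \<Longrightarrow> 0 \<le> \<phi> \<theta> \<and> \<phi> \<theta> \<le> B"
    and norm_e: "norm e = 1"
begin

lemma space_\<tau>: "space \<tau> = topspace X"
  using sets_eq_imp_space_eq[OF sets_\<tau>] by simp

lemma \<phi>_measurable_borel_of: "\<phi> \<in> borel_measurable (borel_of X)"
  using \<phi>_cont by (rule measurable_borel_of)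

lemma \<phi>_measurable [measurable]: "\<phi> \<in> borel_measurable \<tau>"
  using \<phi>_measurable_borel_of measurable_cong_sets[OF sets_\<tau> refl] by blast

lemma AE_\<phi>: "AE \<theta> in \<tau>. 0 \<le> \<phi> \<theta> \<and> \<phi> \<theta> \<le> B"
  using \<phi>_bounds by (auto simp: space_\<tau>)

lemma integrable_\<phi>_mult:
  assumes "integrable \<tau> f" shows "integrable \<tau> (\<lambda>\<theta>. \<phi> \<theta> * f \<theta>)"
proof (rule Bochner_Integration.integrable_bound)
  show "integrable \<tau> (\<lambda>\<theta>. B * f \<theta>)" using assms by simp
  show "AE \<theta> in \<tau>. norm (\<phi> \<theta> * f \<theta>) \<le> norm (B * f \<theta>)"
    using AE_\<phi> by eventually_elim (auto simp: abs_mult intro!: mult_right_mono)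
qed (use assms in auto)

text \<open>The feature moves along a single line and the loss reads off the coordinate on it, so
  the objective is linear in the measure and the loss has the constant gradient
  \<open>e\<close>.\<close>

definition problem :: "('a, 'f) objective" where
  "problem = \<lparr>feature = (\<lambda>\<theta>. \<phi> \<theta> *\<^sub>R e), loss = (\<lambda>x. x \<bullet> e), regs = [Prob_Indicator]\<rparr>"

lemma gderiv_loss: "GDERIV (loss problem) x :> e"
  unfolding problem_def by (auto simp: gderiv_def intro!: derivative_eq_intros)

lemma gradient_loss: "gradient (loss problem) x = e"
  unfolding gradient_def
proof (rule the_equality)
  show "GDERIV (loss problem) x :> e" by (rule gderiv_loss)
  fix g assume "GDERIV (loss problem) x :> g"
  then have "(\<lambda>v. v \<bullet> g) = (\<lambda>v. v \<bullet> e)"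
    using gderiv_loss[of x] unfolding gderiv_def by (rule has_derivative_unique)
  then have "(g - e) \<bullet> (g - e) = 0" by (metis inner_diff_right right_minus_eq)
  then show "g = e" by simp
qed

lemma assumption_A1_problem:
  assumes "topol M = X"
  shows "assumption_A1 M problem"
proof -
  have "continuous_map X euclidean (feature problem)"
    using \<phi>_cont by (simp add: problem_def continuous_map_atin tendsto_scaleR)
  moreover have "convex_on UNIV (loss problem)"
    by (rule convex_onI) (auto simp: problem_def inner_add_left)
  moreover have "0-lipschitz_on UNIV (gradient (loss problem))"
    by (rule lipschitz_onI) (auto simp: gradient_loss)
  ultimately show ?thesis
    using assms gderiv_loss unfolding assumption_A1_def by (auto simp: problem_def)
qed

text \<open>By linearity the differential is the same at every \<open>\<mu>\<close>; each proximal
  step therefore tilts the density by the same factor \<open>exp (- s * \<phi>)\<close>, up to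
  normalization.\<close>

lemma G_bar_diff_problem: "G_bar_diff X problem \<mu> \<theta> = \<phi> \<theta>"
  using norm_e by (simp add: G_bar_diff_def gradient_loss)
    (simp add: problem_def norm_eq_1)

text \<open>Stated for arbitrary probability measures so that it evaluates the objective both at
  densities and at the Dirac minimizer.\<close>

lemma F_bar_prob_measure:
  assumes N: "prob_space N" "sets N = sets (borel_of X)"
    and \<mu>: "\<And>A. A \<in> sets N \<Longrightarrow> \<mu> A = measure N A"
  shows "F_bar X problem \<mu> = ereal (integral\<^sup>L N \<phi>)"
proof -
  interpret N: prob_space N by fact
  have space: "space N = topspace X"
    using sets_eq_imp_space_eq[OF N(2)] by simp
  have fin: "finite_measure N" by unfold_locales
  have meas: "\<phi> \<in> borel_measurable N"
    using \<phi>_measurable_borel_of measurable_cong_sets[OF N(2) refl] by blast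
  have "integrable N \<phi>"
    using \<phi>_bounds meas by (intro N.integrable_const_bound[of _ B]) (auto simp: space)
  then have "signed_integral X \<mu> (feature problem) = (integral\<^sup>L N \<phi>) *\<^sub>R e"
    by (subst signed_integral_finite_measure[OF fin N(2) \<mu>]) (auto simp: problem_def)
  then have "G_bar X problem \<mu> = integral\<^sup>L N \<phi>"
    using norm_e by (simp add: G_bar_def) (simp add: problem_def norm_eq_1)
  moreover have "\<mu> \<in> probability_measures X"
    using finite_measure_in_nonneg_measures[OF fin N(2) \<mu>] \<mu>[of "space N"]
    by (simp add: probability_measures_def N.prob_space flip: space)
  then have "H_bar X problem \<mu> = 0"
    by (simp add: H_bar_def problem_def convex_indicator_def)
  ultimately show ?thesis by (simp add: F_bar_def)
qed

text \<open>The part of \<open>L1\<close> on which the regularizer is finite, by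
  \<open>H_dens_problem\<close>. Set functions see \<open>f\<close> only up to null sets, hence
  nonnegativity almost everywhere.\<close>

definition densities :: "('a \<Rightarrow> real) set" where
  "densities = {f. integrable \<tau> f \<and> (AE \<theta> in \<tau>. 0 \<le> f \<theta>) \<and> (\<integral>\<theta>. f \<theta> \<partial>\<tau>) = 1}"

lemma density_prob_space:
  assumes "f \<in> densities"
  shows "prob_space (density \<tau> f)"
proof (rule prob_spaceI)
  have "emeasure (density \<tau> f) (space (density \<tau> f)) = (\<integral>\<^sup>+\<theta>. ennreal (f \<theta>) \<partial>\<tau>)"
    using assms by (auto simp: densities_def emeasure_density intro!: nn_integral_cong)
  also have "\<dots> = 1"
    using assms by (simp add: densities_def nn_integral_eq_integral)
  finally show "emeasure (density \<tau> f) (space (density \<tau> f)) = 1" .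
qed

lemma F_dens_density:
  assumes "f \<in> densities"
  shows "F_dens X \<tau> problem f = ereal (\<integral>\<theta>. \<phi> \<theta> * f \<theta> \<partial>\<tau>)"
proof -
  have "F_dens X \<tau> problem f = ereal (integral\<^sup>L (density \<tau> f) \<phi>)"
    unfolding F_dens_def
    using assms density_prob_space[OF assms]
    by (intro F_bar_prob_measure signed_density_nonneg_eq_measure(2)) (auto simp: densities_def sets_\<tau>)
  also have "integral\<^sup>L (density \<tau> f) \<phi> = (\<integral>\<theta>. f \<theta> *\<^sub>R \<phi> \<theta> \<partial>\<tau>)"
    using assms by (intro integral_density) (auto simp: densities_def)
  finally show ?thesis by (simp add: mult.commute)
qed

lemma H_dens_problem:
  assumes "integrable \<tau> f"
  shows "H_dens X \<tau> problem f = (if f \<in> densities then 0 else \<infinity>)"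
proof -
  have "signed_density \<tau> f \<in> probability_measures X \<longleftrightarrow> f \<in> densities"
  proof
    assume *: "signed_density \<tau> f \<in> probability_measures X"
    then have "AE \<theta> in \<tau>. 0 \<le> f \<theta>"
      using assms by (intro AE_nonneg_if_signed_density_nonneg)
        (auto simp: probability_measures_def nonneg_measures_def sets_\<tau>)
    moreover have "(\<integral>\<theta>. f \<theta> \<partial>\<tau>) = 1"
      using * set_integral_space[OF assms]
      by (simp add: probability_measures_def signed_density_def space_\<tau>)
    ultimately show "f \<in> densities" using assms by (simp add: densities_def)
  next
    assume f: "f \<in> densities"
    then have "signed_density \<tau> f \<in> nonneg_measures X"
      by (intro finite_measure_in_nonneg_measures[of "density \<tau> f"] signed_density_nonneg_eq_measure)
        (auto simp: densities_def sets_\<tau>)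
    then show "signed_density \<tau> f \<in> probability_measures X"
      using f set_integral_space[OF assms]
      by (simp add: probability_measures_def signed_density_def space_\<tau> densities_def)
  qed
  then show ?thesis
    by (simp add: H_dens_def H_bar_def problem_def convex_indicator_def)
qed

lemma F_dens_not_density:
  assumes "integrable \<tau> f" "f \<notin> densities"
  shows "F_dens X \<tau> problem f = \<infinity>"
  using H_dens_problem[OF assms(1)] assms(2) by (simp add: F_dens_def F_bar_def H_dens_def)

section \<open>Gibbs densities and the exact solution of a proximal step\<close>

definition partition_function :: "real \<Rightarrow> real" where
  "partition_function t = (\<integral>\<theta>. exp (- t * \<phi> \<theta>) \<partial>\<tau>)"

definition gibbs :: "real \<Rightarrow> 'a \<Rightarrow> real" where
  "gibbs t \<theta> = exp (- t * \<phi> \<theta>) / partition_function t"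

lemma integrable_exp_\<phi>: "integrable \<tau> (\<lambda>\<theta>. exp (t * \<phi> \<theta>))"
proof (rule integrable_const_bound[of _ "exp (\<bar>t\<bar> * B)"])
  show "AE \<theta> in \<tau>. norm (exp (t * \<phi> \<theta>)) \<le> exp (\<bar>t\<bar> * B)"
    using AE_\<phi>
  proof eventually_elim
    case (elim \<theta>)
    have "t * \<phi> \<theta> \<le> \<bar>t\<bar> * \<phi> \<theta>" using elim by (intro mult_right_mono) auto
    also have "\<dots> \<le> \<bar>t\<bar> * B" using elim by (intro mult_left_mono) auto
    finally show ?case by simp
  qed
qed simp

lemma partition_pos: "0 < partition_function t"
proof -
  have "exp (- (\<bar>t\<bar> * B)) \<le> partition_function t"
    unfolding partition_function_def
  proof (rule integral_ge_const[OF integrable_exp_\<phi>])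
    show "AE \<theta> in \<tau>. exp (- (\<bar>t\<bar> * B)) \<le> exp (- t * \<phi> \<theta>)"
      using AE_\<phi>
    proof eventually_elim
      case (elim \<theta>)
      have "t * \<phi> \<theta> \<le> \<bar>t\<bar> * \<phi> \<theta>" using elim by (intro mult_right_mono) auto
      also have "\<dots> \<le> \<bar>t\<bar> * B" using elim by (intro mult_left_mono) auto
      finally show ?case by simp
    qed
  qed
  then show ?thesis by (rule less_le_trans[OF exp_gt_zero])
qed

lemma gibbs_pos: "0 < gibbs t \<theta>"
  by (simp add: gibbs_def partition_pos)

lemma gibbs_density: "gibbs t \<in> densities"
  using integrable_exp_\<phi>[of "- t"] partition_pos[of t] gibbs_pos[of t]
  by (auto simp: densities_def gibbs_def[abs_def] partition_function_def less_imp_le)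

lemma gibbs_0: "gibbs 0 = (\<lambda>_. 1)"
  by (simp add: gibbs_def[abs_def] partition_function_def prob_space)

text \<open>The logarithm of \<open>gibbs t\<close> is affine in \<open>\<phi>\<close>, so passing
  from \<open>gibbs t\<close> to \<open>gibbs (t + s)\<close> changes the divergence of
  \<open>f\<close> by a term affine in \<open>f\<close>. After division by \<open>s\<close> its
  \<open>\<phi>\<close> part cancels the linear part of the objective and, as \<open>f\<close> has
  mass 1, the rest is constant. This is the entropic analogue of completing the square.\<close>

lemma pgm_step_objective_gibbs:
  assumes "s > 0" "integrable \<tau> g" "AE \<theta> in \<tau>. g \<theta> = gibbs t \<theta>"
  obtains K where
    "\<And>f. f \<in> densities \<Longrightarrow> pgm_step_objective X \<tau> problem entropy entropy_deriv s g f
        = ereal K + ereal (1 / s) * enn2ereal (\<integral>\<^sup>+\<theta>. ennreal (kl_integrand (f \<theta>) (gibbs (t + s) \<theta>)) \<partial>\<tau>)"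
    "\<And>f. integrable \<tau> f \<Longrightarrow> f \<notin> densities \<Longrightarrow>
      pgm_step_objective X \<tau> problem entropy entropy_deriv s g f = \<infinity>"
proof -
  define \<beta> where "\<beta> = ln (partition_function (t + s)) - ln (partition_function t)"
  define K where "K = G_dens X \<tau> problem g - (\<integral>\<theta>. \<phi> \<theta> * g \<theta> \<partial>\<tau>) - \<beta> / s"
  have ln_gibbs: "ln (gibbs u \<theta>) = - u * \<phi> \<theta> - ln (partition_function u)" for u \<theta>
    using partition_pos[of u] by (simp add: gibbs_def ln_div)
  have "pgm_step_objective X \<tau> problem entropy entropy_deriv s g f
        = ereal K + ereal (1 / s) * enn2ereal (\<integral>\<^sup>+\<theta>. ennreal (kl_integrand (f \<theta>) (gibbs (t + s) \<theta>)) \<partial>\<tau>)"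
    if f: "f \<in> densities" for f
  proof -
    have f': "integrable \<tau> f" "AE \<theta> in \<tau>. 0 \<le> f \<theta>" "(\<integral>\<theta>. f \<theta> \<partial>\<tau>) = 1"
      using f by (auto simp: densities_def)
    have [measurable]: "f \<in> borel_measurable \<tau>" "\<And>u. gibbs u \<in> borel_measurable \<tau>"
      using f' by (auto simp: gibbs_def[abs_def])
    have [simp]: "integrable \<tau> (gibbs u)" "(\<integral>\<theta>. gibbs u \<theta> \<partial>\<tau>) = 1" for u
      using gibbs_density[of u] by (auto simp: densities_def)
    \<comment> \<open>\<open>r\<close> is the difference of the two divergence integrands; its last
      two terms cancel on integration since both Gibbs densities have mass 1.\<close>
    define r where "r \<theta> = - s * (\<phi> \<theta> * f \<theta>) - \<beta> * f \<theta> + gibbs t \<theta> - gibbs (t + s) \<theta>" for \<theta>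
    have r: "integrable \<tau> r" "(\<integral>\<theta>. r \<theta> \<partial>\<tau>) = - s * (\<integral>\<theta>. \<phi> \<theta> * f \<theta> \<partial>\<tau>) - \<beta>"
      using f' integrable_\<phi>_mult[OF f'(1)] by (auto simp: r_def[abs_def])
    have "bregman_div entropy entropy_deriv \<tau> f g
        = enn2ereal (\<integral>\<^sup>+\<theta>. ennreal (kl_integrand (f \<theta>) (g \<theta>)) \<partial>\<tau>)"
      using f' assms(3) by (intro bregman_div_entropy) (auto simp: gibbs_pos elim: AE_mp)
    also have "(\<integral>\<^sup>+\<theta>. ennreal (kl_integrand (f \<theta>) (g \<theta>)) \<partial>\<tau>)
        = (\<integral>\<^sup>+\<theta>. ennreal (kl_integrand (f \<theta>) (gibbs t \<theta>)) \<partial>\<tau>)"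
      using assms(3) by (intro nn_integral_cong_AE) auto
    \<comment> \<open>The entropy of an \<open>L1\<close> density may be infinite, so the finite
      integral of \<open>r\<close> is split off instead of subtracting two divergences.\<close>
    also have "enn2ereal \<dots> = enn2ereal (\<integral>\<^sup>+\<theta>. ennreal (kl_integrand (f \<theta>) (gibbs (t + s) \<theta>)) \<partial>\<tau>)
        + ereal (\<integral>\<theta>. r \<theta> \<partial>\<tau>)"
    proof (rule nn_integral_add_integrable)
      show "AE \<theta> in \<tau>. kl_integrand (f \<theta>) (gibbs t \<theta>) = kl_integrand (f \<theta>) (gibbs (t + s) \<theta>) + r \<theta>"
        by (rule AE_I2) (simp add: kl_integrand_def ln_gibbs r_def \<beta>_def algebra_simps)
      show "AE \<theta> in \<tau>. 0 \<le> kl_integrand (f \<theta>) (gibbs u \<theta>)" for u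
        using f'(2) by eventually_elim (simp add: kl_integrand_nonneg gibbs_pos)
      show "AE \<theta> in \<tau>. 0 \<le> kl_integrand (f \<theta>) (gibbs u \<theta>)" for u
        using f'(2) by eventually_elim (simp add: kl_integrand_nonneg gibbs_pos)
    qed (use r in \<open>auto simp: kl_integrand_def\<close>)
    finally have D: "bregman_div entropy entropy_deriv \<tau> f g =
      enn2ereal (\<integral>\<^sup>+\<theta>. ennreal (kl_integrand (f \<theta>) (gibbs (t + s) \<theta>)) \<partial>\<tau>)
        + ereal (\<integral>\<theta>. r \<theta> \<partial>\<tau>)" .
    have lin: "(\<integral>\<theta>. \<phi> \<theta> * (f \<theta> - g \<theta>) \<partial>\<tau>) = (\<integral>\<theta>. \<phi> \<theta> * f \<theta> \<partial>\<tau>) - (\<integral>\<theta>. \<phi> \<theta> * g \<theta> \<partial>\<tau>)"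
      using integrable_\<phi>_mult[OF f'(1)] integrable_\<phi>_mult[OF assms(2)]
      by (simp add: right_diff_distrib)
    \<comment> \<open>Distributing over a possibly infinite summand is sound because the other one
      is finite.\<close>
    have "ereal (1 / s) * (enn2ereal k + ereal a) = ereal (1 / s) * enn2ereal k + ereal (a / s)" for k a
      using assms(1) by (cases k) (auto simp: field_simps)
    then show ?thesis
      using assms(1) f H_dens_problem[OF f'(1)] 
      unfolding pgm_step_objective_def G_dens_diff_def G_bar_diff_problem lin D r(2)
      by (cases "enn2ereal (\<integral>\<^sup>+\<theta>. ennreal (kl_integrand (f \<theta>) (gibbs (t + s) \<theta>)) \<partial>\<tau>)")
        (auto simp: K_def field_simps)
  qed
  moreover have "pgm_step_objective X \<tau> problem entropy entropy_deriv s g f = \<infinity>"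
    if "integrable \<tau> f" "f \<notin> densities" for f
    using that assms(1) H_dens_problem[OF that(1)]
    by (simp add: pgm_step_objective_def bregman_div_def)
  ultimately show thesis using that by blast
qed

text \<open>Up to a finite constant and the factor \<open>1 / s\<close>, the step objective is the
  divergence from \<open>gibbs (t + s)\<close>, which is nonnegative and vanishes exactly for
  densities equal to it almost everywhere.\<close>

lemma
  assumes "s > 0" "integrable \<tau> g" "AE \<theta> in \<tau>. g \<theta> = gibbs t \<theta>"
  shows is_arg_min_gibbs:
      "is_arg_min (pgm_step_objective X \<tau> problem entropy entropy_deriv s g) (\<lambda>h. h \<in> L1 \<tau>) (gibbs (t + s))"
    and is_arg_min_imp_gibbs:
      "is_arg_min (pgm_step_objective X \<tau> problem entropy entropy_deriv s g) (\<lambda>h. h \<in> L1 \<tau>) f \<Longrightarrow>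
        AE \<theta> in \<tau>. f \<theta> = gibbs (t + s) \<theta>"
proof -
  let ?J = "pgm_step_objective X \<tau> problem entropy entropy_deriv s g"
  let ?D = "\<lambda>f. \<integral>\<^sup>+\<theta>. ennreal (kl_integrand (f \<theta>) (gibbs (t + s) \<theta>)) \<partial>\<tau>"
  obtain K where K: "\<And>f. f \<in> densities \<Longrightarrow> ?J f = ereal K + ereal (1 / s) * enn2ereal (?D f)"
    and inf: "\<And>f. integrable \<tau> f \<Longrightarrow> f \<notin> densities \<Longrightarrow> ?J f = \<infinity>"
    using pgm_step_objective_gibbs[OF assms] by blast
  have h: "?J (gibbs (t + s)) = ereal K"
    by (simp add: K gibbs_density kl_integrand_def zero_ennreal.rep_eq)
  have ge: "ereal K \<le> ?J f" if "integrable \<tau> f" for f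
  proof (cases "f \<in> densities")
    case True
    have "0 \<le> ereal (1 / s) * enn2ereal (?D f)" using assms(1) by simp
    then show ?thesis using add_left_mono[of 0 _ "ereal K"] by (simp add: K True)
  qed (simp add: inf that)
  show "is_arg_min ?J (\<lambda>h. h \<in> L1 \<tau>) (gibbs (t + s))"
    using gibbs_density[of "t + s"] ge
    by (auto simp: is_arg_min_def h not_less densities_def)
  show "AE \<theta> in \<tau>. f \<theta> = gibbs (t + s) \<theta>" if "is_arg_min ?J (\<lambda>h. h \<in> L1 \<tau>) f"
  proof -
    have f: "integrable \<tau> f" and "\<not> ?J (gibbs (t + s)) < ?J f"
      using that gibbs_density[of "t + s"] by (auto simp: is_arg_min_def densities_def)
    then have le: "?J f \<le> ereal K" by (simp add: h not_less)
    \<comment> \<open>Elsewhere the objective is infinite, which exceeds the finite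
      \<open>K\<close>.\<close>
    then have f': "f \<in> densities" using inf[OF f] by force
    have "?D f = 0"
    proof (cases "?D f")
      case (real x)
      then have "K + x / s \<le> K"
        using le by (simp add: K[OF f'] enn2ereal_ennreal)
      then show ?thesis using real assms(1) by (simp add: field_simps)
    next
      case top
      then show ?thesis using le assms(1) by (simp add: K[OF f'])
    qed
    moreover have "(\<lambda>\<theta>. ennreal (kl_integrand (f \<theta>) (gibbs (t + s) \<theta>))) \<in> borel_measurable \<tau>"
      using f by (simp add: kl_integrand_def gibbs_def)
    ultimately have "AE \<theta> in \<tau>. ennreal (kl_integrand (f \<theta>) (gibbs (t + s) \<theta>)) = 0"
      by (simp add: nn_integral_0_iff_AE)
    moreover have "AE \<theta> in \<tau>. 0 \<le> f \<theta>" using f' by (simp add: densities_def)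
    ultimately show ?thesis
    proof eventually_elim
      case (elim \<theta>)
      then have "kl_integrand (f \<theta>) (gibbs (t + s) \<theta>) \<le> 0" by (simp add: ennreal_eq_0_iff)
      then have "kl_integrand (f \<theta>) (gibbs (t + s) \<theta>) = 0"
        using kl_integrand_nonneg[OF elim(2) gibbs_pos] by (rule antisym)
      then show ?case using kl_integrand_eq_0_iff[OF elim(2) gibbs_pos] by simp
    qed
  qed
qed

text \<open>Existence of a run, without which a rate for all runs could hold vacuously. The start is
  right because \<open>gibbs 0\<close> is the constant 1 on a probability space.\<close>

lemma pgm_iterates_gibbs:
  assumes "s > 0"
  shows "pgm_iterates X \<tau> problem entropy entropy_deriv s (\<lambda>_. 1) (\<lambda>k. gibbs (s * real k))"
proof -
  have "H_dens X \<tau> problem (\<lambda>_. 1) = 0"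
    using H_dens_problem[of "\<lambda>_. 1"] by (simp add: densities_def prob_space)
  moreover have "is_arg_min (pgm_step_objective X \<tau> problem entropy entropy_deriv s (gibbs (s * real k)))
      (\<lambda>h. h \<in> L1 \<tau>) (gibbs (s * real (Suc k)))" for k
    using is_arg_min_gibbs[OF assms, of "gibbs (s * real k)" "s * real k"] gibbs_density
    by (simp add: densities_def algebra_simps)
  ultimately show ?thesis by (simp add: pgm_iterates_def gibbs_0)
qed

text \<open>Minimizers are unique only almost everywhere, so the induction analyses the step from
  \<open>f k\<close> itself and carries its integrability along.\<close>

lemma pgm_iterates_imp_gibbs:
  assumes "s > 0" "pgm_iterates X \<tau> problem entropy entropy_deriv s (\<lambda>_. 1) f"
  shows "integrable \<tau> (f k) \<and> (AE \<theta> in \<tau>. f k \<theta> = gibbs (s * real k) \<theta>)"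
proof (induction k)
  case 0
  then show ?case using assms(2) by (simp add: pgm_iterates_def gibbs_0)
next
  case (Suc k)
  have step: "is_arg_min (pgm_step_objective X \<tau> problem entropy entropy_deriv s (f k)) (\<lambda>h. h \<in> L1 \<tau>) (f (Suc k))"
    using assms(2) by (simp add: pgm_iterates_def)
  have "AE \<theta> in \<tau>. f (Suc k) \<theta> = gibbs (s * real k + s) \<theta>"
    using is_arg_min_imp_gibbs[OF assms(1) _ _ step] Suc by blast
  then show ?case using step by (simp add: is_arg_min_def algebra_simps)
qed

section \<open>Two-sided rate for the Gibbs mean\<close>

definition gibbs_mean :: "real \<Rightarrow> real" where
  "gibbs_mean t = (\<integral>\<theta>. \<phi> \<theta> * gibbs t \<theta> \<partial>\<tau>)"

lemma F_dens_AE_gibbs: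
  assumes "integrable \<tau> f" "AE \<theta> in \<tau>. f \<theta> = gibbs t \<theta>"
  shows "F_dens X \<tau> problem f = ereal (gibbs_mean t)"
proof -
  have g: "integrable \<tau> (gibbs t)" "(\<integral>\<theta>. gibbs t \<theta> \<partial>\<tau>) = 1"
    using gibbs_density[of t] by (auto simp: densities_def)
  have "(\<integral>\<theta>. f \<theta> \<partial>\<tau>) = 1"
    using integral_cong_AE[of f \<tau> "gibbs t"] assms g by auto
  moreover have "AE \<theta> in \<tau>. 0 \<le> f \<theta>"
    using assms(2) by eventually_elim (simp add: gibbs_pos less_imp_le)
  moreover have "(\<integral>\<theta>. \<phi> \<theta> * f \<theta> \<partial>\<tau>) = gibbs_mean t"
    unfolding gibbs_mean_def using assms g by (intro integral_cong_AE) auto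
  ultimately show ?thesis
    using F_dens_density[of f] assms(1) by (simp add: densities_def)
qed

lemma integral_\<phi>_exp: "(\<integral>\<theta>. \<phi> \<theta> * exp (- t * \<phi> \<theta>) \<partial>\<tau>) = partition_function t * gibbs_mean t"
  using partition_pos[of t] by (simp add: gibbs_mean_def gibbs_def)

lemma integrable_\<phi>_exp: "integrable \<tau> (\<lambda>\<theta>. \<phi> \<theta> * exp (t * \<phi> \<theta>))"
  by (rule integrable_\<phi>_mult[OF integrable_exp_\<phi>])

text \<open>The product \<open>partition_function t * gibbs_mean t\<close> is minus the derivative
  of the convex partition function; the bound says that the tangent at \<open>t\<close> lies below
  the graph at \<open>t / 2\<close>.\<close>

lemma gibbs_mean_upper:
  assumes "t > 0"
  shows "t * partition_function t * gibbs_mean t \<le> 2 * (partition_function (t / 2) - partition_function t)"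
proof -
  have "(\<integral>\<theta>. t * (\<phi> \<theta> * exp (- t * \<phi> \<theta>)) \<partial>\<tau>)
      \<le> (\<integral>\<theta>. 2 * (exp (- (t / 2) * \<phi> \<theta>) - exp (- t * \<phi> \<theta>)) \<partial>\<tau>)"
  proof (intro integral_mono integrable_mult_right Bochner_Integration.integrable_diff
      integrable_\<phi>_exp integrable_exp_\<phi>)
    fix \<theta>
    have "exp (- t * \<phi> \<theta>) * (1 + t * \<phi> \<theta> / 2) \<le> exp (- t * \<phi> \<theta>) * exp (t * \<phi> \<theta> / 2)"
      by (intro mult_left_mono exp_ge_add_one_self) auto
    also have "\<dots> = exp (- (t / 2) * \<phi> \<theta>)"
      by (simp add: field_simps flip: exp_add)
    finally show "t * (\<phi> \<theta> * exp (- t * \<phi> \<theta>)) \<le> 2 * (exp (- (t / 2) * \<phi> \<theta>) - exp (- t * \<phi> \<theta>))"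
      by (simp add: algebra_simps)
  qed
  then show ?thesis
    using integrable_exp_\<phi>[of "- t"] integrable_exp_\<phi>[of "- (t / 2)"] integral_\<phi>_exp[of t]
    by (simp add: partition_function_def mult.assoc)
qed

lemma \<phi>_exp_lower: "exp (- t * x) - exp (- (4 * t) * x) \<le> 3 * (t * (x * exp (- t * x)))" for x :: real
proof -
  have "exp (- t * x) * (1 + - 3 * t * x) \<le> exp (- t * x) * exp (- 3 * t * x)"
    by (intro mult_left_mono exp_ge_add_one_self) auto
  also have "\<dots> = exp (- (4 * t) * x)"
    by (simp add: field_simps flip: exp_add)
  finally show ?thesis by (simp add: algebra_simps)
qed

text \<open>The same tangent, compared with the graph at \<open>4 * t\<close>. The ratio 4 matches
  \<open>torus_energy_half\<close>: halving the argument divides the energy by at most 4.\<close>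

lemma gibbs_mean_lower:
  "partition_function t - partition_function (4 * t) \<le> 3 * t * partition_function t * gibbs_mean t"
proof -
  have "(\<integral>\<theta>. exp (- t * \<phi> \<theta>) - exp (- (4 * t) * \<phi> \<theta>) \<partial>\<tau>)
      \<le> (\<integral>\<theta>. 3 * (t * (\<phi> \<theta> * exp (- t * \<phi> \<theta>))) \<partial>\<tau>)"
    by (intro integral_mono integrable_mult_right Bochner_Integration.integrable_diff
      integrable_\<phi>_exp integrable_exp_\<phi> \<phi>_exp_lower)
  then show ?thesis
    using integrable_exp_\<phi>[of "- t"] integrable_exp_\<phi>[of "- (4 * t)"] integral_\<phi>_exp[of t]
    by (simp add: partition_function_def mult.assoc)
qed

text \<open>Provides the lower bound for small \<open>t\<close>: the partition function is at most
  1, so \<open>gibbs t\<close> is at least \<open>exp (- t * B)\<close>.\<close>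

lemma gibbs_mean_ge:
  assumes "t \<ge> 0"
  shows "exp (- t * B) * (\<integral>\<theta>. \<phi> \<theta> \<partial>\<tau>) \<le> gibbs_mean t"
proof -
  have "partition_function t \<le> 1"
    unfolding partition_function_def
    using assms AE_\<phi> by (intro integral_le_const integrable_exp_\<phi>) (auto elim: AE_mp)
  have "(\<integral>\<theta>. exp (- t * B) * \<phi> \<theta> \<partial>\<tau>) \<le> (\<integral>\<theta>. \<phi> \<theta> * gibbs t \<theta> \<partial>\<tau>)"
  proof (rule integral_mono_AE)
    show "integrable \<tau> (\<lambda>\<theta>. \<phi> \<theta> * gibbs t \<theta>)"
      using gibbs_density[of t] by (intro integrable_\<phi>_mult) (simp add: densities_def)
    show "AE \<theta> in \<tau>. exp (- t * B) * \<phi> \<theta> \<le> \<phi> \<theta> * gibbs t \<theta>"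
      using AE_\<phi>
    proof eventually_elim
      case (elim \<theta>)
      have "exp (- t * B) \<le> exp (- t * \<phi> \<theta>)"
        using assms elim by (auto intro: mult_left_mono)
      also have "\<dots> \<le> gibbs t \<theta>"
        using \<open>partition_function t \<le> 1\<close> partition_pos[of t] by (simp add: gibbs_def le_divide_eq)
      finally show ?case using elim by (subst mult.commute) (auto intro: mult_left_mono)
    qed
  qed (use integrable_\<phi>_exp[of 0] in auto)
  then show ?thesis by (simp add: gibbs_mean_def)
qed

lemma gibbs_mean_rate:
  assumes "\<And>t. t > 0 \<Longrightarrow> partition_function (t / 2) \<le> K * partition_function t"
    and "\<And>t. t \<ge> 1 \<Longrightarrow> partition_function (4 * t) \<le> 3 / 4 * partition_function t" and "s > 0"
  shows "\<exists>c>0. \<exists>C>0. \<forall>k\<ge>1. c / real k \<le> gibbs_mean (s * real k) \<and> gibbs_mean (s * real k) \<le> C / real k"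
proof -
  \<comment> \<open>Writing \<open>\<bar>K\<bar> + 1\<close> for \<open>K - 1\<close> makes the
    constant positive whatever \<open>K\<close> is.\<close>
  have upper: "t * gibbs_mean t \<le> 2 * (\<bar>K\<bar> + 1)" if "t > 0" for t
  proof -
    have "partition_function t * (t * gibbs_mean t) \<le> 2 * (K * partition_function t - partition_function t)"
      using gibbs_mean_upper[OF that] assms(1)[OF that] by (simp add: mult_ac)
    also have "\<dots> = partition_function t * (2 * (K - 1))" by (simp add: algebra_simps)
    finally have "t * gibbs_mean t \<le> 2 * (K - 1)"
      using partition_pos[of t] by simp
    also have "2 * (K - 1) \<le> 2 * (\<bar>K\<bar> + 1)" by simp
    finally show ?thesis .
  qed
  \<comment> \<open>\<open>1 / 12\<close> is the relative loss \<open>1 - 3 / 4\<close> between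
    \<open>t\<close> and \<open>4 * t\<close>, divided by the factor 3 of
    \<open>gibbs_mean_lower\<close>.\<close>
  have lower: "1 / 12 \<le> t * gibbs_mean t" if "t \<ge> 1" for t
  proof -
    have "partition_function t * (1 / 4) \<le> partition_function t * (3 * (t * gibbs_mean t))"
      using gibbs_mean_lower[of t] assms(2)[OF that] by (simp add: mult_ac)
    then show ?thesis using partition_pos[of t] by simp
  qed
  let ?m = "\<integral>\<theta>. \<phi> \<theta> \<partial>\<tau>"
  \<comment> \<open>A potential vanishing almost everywhere would have Gibbs mean 0 at time 1,
    against \<open>lower\<close>.\<close>
  have m: "?m > 0"
  proof -
    have "(\<integral>\<theta>. \<phi> \<theta> * exp (- 1 * \<phi> \<theta>) \<partial>\<tau>) \<le> ?m"
    proof (rule integral_mono_AE)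
      show "AE \<theta> in \<tau>. \<phi> \<theta> * exp (- 1 * \<phi> \<theta>) \<le> \<phi> \<theta>"
        using AE_\<phi> by eventually_elim (simp add: mult_left_le)
    qed (use integrable_\<phi>_exp[of "- 1"] integrable_\<phi>_exp[of 0] in auto)
    moreover have "gibbs_mean 1 > 0" using lower[of 1] by simp
    ultimately show ?thesis
      using integral_\<phi>_exp[of 1] partition_pos[of 1] by (smt (verit) mult_pos_pos)
  qed
  \<comment> \<open>The first entry handles \<open>s * real k \<ge> 1\<close>, the second the
    earlier steps, where the mean stays away from 0 while \<open>1 / real k\<close> is at most
    1.\<close>
  define c where "c = min (1 / (12 * s)) (exp (- \<bar>B\<bar>) * ?m)"
  have "c / real k \<le> gibbs_mean (s * real k)" if "k \<ge> 1" for k :: nat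
  proof (cases "s * real k \<ge> 1")
    case True
    have "c / real k \<le> 1 / (12 * s) / real k"
      by (intro divide_right_mono) (auto simp: c_def)
    also have "\<dots> \<le> gibbs_mean (s * real k)"
      using lower[OF True] that assms(3) by (simp add: field_simps)
    finally show ?thesis .
  next
    case False
    have "s * real k * B \<le> s * real k * \<bar>B\<bar>" using assms(3) by (intro mult_left_mono) auto
    also have "\<dots> \<le> 1 * \<bar>B\<bar>" using False by (intro mult_right_mono) auto
    finally have "s * real k * B \<le> \<bar>B\<bar>" by simp
    then have "exp (- \<bar>B\<bar>) * ?m \<le> exp (- (s * real k) * B) * ?m"
      using m by (intro mult_right_mono) auto
    also have "\<dots> \<le> gibbs_mean (s * real k)" using assms(3) by (intro gibbs_mean_ge) auto
    finally have "c \<le> gibbs_mean (s * real k)" by (simp add: c_def)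
    moreover have "c / real k \<le> c / 1"
      using that m assms(3) by (intro divide_left_mono) (auto simp: c_def)
    ultimately show ?thesis by simp
  qed
  moreover have "gibbs_mean (s * real k) \<le> (2 * (\<bar>K\<bar> + 1) / s) / real k" if "k \<ge> 1" for k :: nat
    using upper[of "s * real k"] that assms(3) by (simp add: field_simps)
  moreover have "c > 0" using m assms(3) by (simp add: c_def)
  moreover have "2 * (\<bar>K\<bar> + 1) / s > 0" using assms(3) by simp
  ultimately show ?thesis by blast
qed

text \<open>The value 0 need not be attained by a density, so the upper bound comes from a
  minimizing sequence: the Gibbs densities at integer times, whose means tend to 0 by the rate with
  \<open>s = 1\<close>.\<close>

lemma inf_F_problem:
  assumes "\<And>t. t > 0 \<Longrightarrow> partition_function (t / 2) \<le> K * partition_function t"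
    and "\<And>t. t \<ge> 1 \<Longrightarrow> partition_function (4 * t) \<le> 3 / 4 * partition_function t"
  shows "inf_F X \<tau> problem = 0"
proof (rule antisym)
  show "0 \<le> inf_F X \<tau> problem"
    unfolding inf_F_def
  proof (rule INF_greatest)
    fix f assume f: "f \<in> L1 \<tau>"
    show "0 \<le> F_dens X \<tau> problem f"
    proof (cases "f \<in> densities")
      case True
      then have "AE \<theta> in \<tau>. 0 \<le> f \<theta>" by (simp add: densities_def)
      with AE_\<phi> have "AE \<theta> in \<tau>. 0 \<le> \<phi> \<theta> * f \<theta>" by eventually_elim simp
      then have "0 \<le> (\<integral>\<theta>. \<phi> \<theta> * f \<theta> \<partial>\<tau>)" by (rule integral_nonneg_AE)
      then show ?thesis by (simp add: F_dens_density[OF True])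
    qed (use f in \<open>simp add: F_dens_not_density\<close>)
  qed
  obtain C where C: "\<And>k::nat. k \<ge> 1 \<Longrightarrow> gibbs_mean (real k) \<le> C / real k"
    using gibbs_mean_rate[OF assms, of 1] by auto
  have "inf_F X \<tau> problem \<le> ereal (C / real k)" if "k \<ge> 1" for k :: nat
  proof -
    have g: "integrable \<tau> (gibbs (real k))" using gibbs_density by (simp add: densities_def)
    then have "inf_F X \<tau> problem \<le> F_dens X \<tau> problem (gibbs (real k))"
      unfolding inf_F_def by (intro INF_lower) simp
    also have "\<dots> = ereal (gibbs_mean (real k))" by (rule F_dens_AE_gibbs[OF g]) simp
    also have "\<dots> \<le> ereal (C / real k)" using C[OF that] by simp
    finally show ?thesis .
  qed
  then have "\<forall>\<^sub>F k in sequentially. inf_F X \<tau> problem \<le> ereal (C / real k)"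
    by (auto simp: eventually_sequentially)
  moreover have "(\<lambda>k. ereal (C / real k)) \<longlonglongrightarrow> ereal 0"
    using lim_const_over_n[of C] by (simp only: tendsto_ereal)
  ultimately show "inf_F X \<tau> problem \<le> 0"
    by (intro tendsto_lowerbound[of "\<lambda>k. ereal (C / real k)" 0 sequentially]) (auto simp: zero_ereal_def)
qed

lemma has_minimizer_problem:
  assumes "inf_F X \<tau> problem = 0" "\<theta> \<in> topspace X" "\<phi> \<theta> = 0"
  shows "has_minimizer X \<tau> problem"
proof -
  let ?N = "return (borel_of X) \<theta>"
  have N: "prob_space ?N" using assms(2) by (intro prob_space_return) simp
  have "F_bar X problem (measure ?N) = ereal (integral\<^sup>L ?N \<phi>)"
    by (rule F_bar_prob_measure[OF N]) auto
  also have "integral\<^sup>L ?N \<phi> = 0"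
    using assms \<phi>_measurable_borel_of by (simp add: integral_return)
  finally have "F_bar X problem (measure ?N) = inf_F X \<tau> problem" by (simp add: assms(1))
  moreover have "measure ?N \<in> nonneg_measures X"
    using N by (intro finite_measure_in_nonneg_measures[of ?N]) (auto simp: prob_space.finite_measure)
  ultimately show ?thesis
    unfolding has_minimizer_def nonneg_measures_def by blast
qed

lemma pgm_rate:
  assumes doubling: "\<And>t. t > 0 \<Longrightarrow> partition_function (t / 2) \<le> K * partition_function t"
      "\<And>t. t \<ge> 1 \<Longrightarrow> partition_function (4 * t) \<le> 3 / 4 * partition_function t"
    and "s > 0" and f: "pgm_iterates X \<tau> problem entropy entropy_deriv s (\<lambda>_. 1) f"
  shows "\<exists>c>0. \<exists>C>0. \<forall>k\<ge>1.
      ereal (c / real k) \<le> F_dens X \<tau> problem (f k) - inf_F X \<tau> problem \<and>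
      F_dens X \<tau> problem (f k) - inf_F X \<tau> problem \<le> ereal (C / real k)"
proof -
  have "F_dens X \<tau> problem (f k) = ereal (gibbs_mean (s * real k))" for k
    using pgm_iterates_imp_gibbs[OF \<open>s > 0\<close> f, of k] by (intro F_dens_AE_gibbs) auto
  then show ?thesis
    using gibbs_mean_rate[OF doubling \<open>s > 0\<close>] inf_F_problem[OF doubling] by simp
qed

end

section \<open>The flat torus\<close>

definition torus_map :: "real ^ 'n::finite \<Rightarrow> complex ^ 'n" where
  "torus_map x = (\<chi> i. cis (2 * pi * x $ i))"

definition torus :: "(complex ^ 'n::finite) set" where
  "torus = range torus_map"

definition unit_box :: "real ^ 'n::finite \<Rightarrow> (real ^ 'n) set" where
  "unit_box b = {x. \<forall>i. \<bar>x $ i - b $ i\<bar> < 1 / 2}"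

text \<open>Half-open, so that every point of the torus has exactly one preimage in it, whereas
  charts need the open \<open>unit_box\<close>.\<close>

definition unit_cell :: "real ^ 'n::finite \<Rightarrow> (real ^ 'n) set" where
  "unit_cell b = {x. \<forall>i. b $ i - 1 / 2 \<le> x $ i \<and> x $ i < b $ i + 1 / 2}"

text \<open>Rotating each component back by the angle of \<open>b\<close> moves the branch cut of
  \<open>Arg\<close> opposite to the centre of the chart.\<close>

definition torus_coord :: "real ^ 'n::finite \<Rightarrow> complex ^ 'n \<Rightarrow> real ^ 'n" where
  "torus_coord b z = (\<chi> i. b $ i + Arg (z $ i * cis (- (2 * pi * b $ i))) / (2 * pi))"

definition torus_chart :: "real ^ 'n::finite \<Rightarrow> (complex ^ 'n, 'n) chart" where
  "torus_chart b = (torus_map ` unit_box b, torus_coord b)"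

text \<open>The identity matrix is a consistent metric because all transition maps are local
  translations.\<close>

definition flat_torus :: "(complex ^ 'n, 'n::finite) riemannian" where
  "flat_torus = \<lparr>topol = top_of_set torus, atlas = range torus_chart, metric = (\<lambda>_ _. mat 1)\<rparr>"

section \<open>Charts, metric and compactness of the torus\<close>

lemma torus_map_nth_mult:
  "torus_map x $ i * cis (- (2 * pi * b $ i)) = cis (2 * pi * (x $ i - b $ i))"
  by (simp add: torus_map_def cis_mult algebra_simps)

lemma torus_coord_torus_map:
  assumes "x \<in> unit_box b"
  shows "torus_coord b (torus_map x) = x"
proof -
  have "Arg (cis (2 * pi * (x $ i - b $ i))) = 2 * pi * (x $ i - b $ i)" for i
  proof (rule Arg_cis)
    have "\<bar>x $ i - b $ i\<bar> < 1 / 2" using assms by (auto simp: unit_box_def)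
    then have "- (1 / 2) < x $ i - b $ i" "x $ i - b $ i < 1 / 2" by linarith+
    then have "2 * pi * - (1 / 2) < 2 * pi * (x $ i - b $ i)"
        "2 * pi * (x $ i - b $ i) < 2 * pi * (1 / 2)"
      by (simp_all only: mult_less_cancel_left_pos pi_gt_zero mult_pos_pos zero_less_numeral)
    then show "2 * pi * (x $ i - b $ i) \<in> {- pi<..pi}" by simp
  qed
  then show ?thesis
    by (simp add: torus_coord_def torus_map_nth_mult vec_eq_iff)
qed

lemma torus_map_eq_iff: "torus_map x = torus_map y \<longleftrightarrow> (\<forall>i. x $ i - y $ i \<in> \<int>)"
proof -
  have "cis (2 * pi * a) = cis (2 * pi * b) \<longleftrightarrow> a - b \<in> \<int>" for a b :: real
  proof -
    have "cis (2 * pi * a) = cis (2 * pi * b) \<longleftrightarrow> (\<exists>n::int. 2 * pi * a = 2 * pi * b + 2 * pi * n)"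
      using sin_cos_eq_iff[of "2 * pi * a" "2 * pi * b"] by (auto simp: complex_eq_iff)
    also have "\<dots> \<longleftrightarrow> (\<exists>n::int. a = b + n)"
      by (simp flip: distrib_left)
    also have "\<dots> \<longleftrightarrow> a - b \<in> \<int>"
      by (auto simp: Ints_def algebra_simps)
    finally show ?thesis .
  qed
  then show ?thesis by (simp add: torus_map_def vec_eq_iff)
qed

lemma abs_Arg_less_pi:
  assumes "w \<notin> \<real>\<^sub>\<le>\<^sub>0"
  shows "\<bar>Arg w\<bar> < pi"
proof -
  have "Arg w \<noteq> pi" using assms by (auto simp: Arg_eq_pi complex_nonpos_Reals_iff)
  then show ?thesis using Arg_bounded[of w] by linarith
qed

text \<open>In this form, as avoidance of the branch cut of \<open>Arg\<close>, both the openness of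
  the chart domain and the continuity of \<open>torus_coord\<close> on it can be read off.\<close>

lemma torus_map_unit_box_eq:
  fixes b :: "real ^ 'n::finite"
  shows "torus_map ` unit_box b = {z \<in> torus. \<forall>i. z $ i * cis (- (2 * pi * b $ i)) \<notin> \<real>\<^sub>\<le>\<^sub>0}"
proof (intro set_eqI iffI)
  fix z assume "z \<in> torus_map ` unit_box b"
  then obtain x where x: "x \<in> unit_box b" "z = torus_map x" by blast
  have "z $ i * cis (- (2 * pi * b $ i)) \<notin> \<real>\<^sub>\<le>\<^sub>0" for i
  proof
    let ?w = "z $ i * cis (- (2 * pi * b $ i))"
    assume "?w \<in> \<real>\<^sub>\<le>\<^sub>0"
    moreover have "?w \<noteq> 0" unfolding x(2) torus_map_nth_mult by simp
    ultimately have "Arg ?w = pi"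
      by (auto simp: Arg_eq_pi complex_nonpos_Reals_iff complex_eq_iff less_le)
    moreover have "torus_coord b z $ i = x $ i" using torus_coord_torus_map[OF x(1)] x(2) by simp
    ultimately have "x $ i - b $ i = 1 / 2" by (simp add: torus_coord_def)
    moreover have "\<bar>x $ i - b $ i\<bar> < 1 / 2" using x(1) by (simp add: unit_box_def)
    ultimately show False by simp
  qed
  then show "z \<in> {z \<in> torus. \<forall>i. z $ i * cis (- (2 * pi * b $ i)) \<notin> \<real>\<^sub>\<le>\<^sub>0}"
    using x by (simp add: torus_def)
next
  fix z assume "z \<in> {z \<in> torus. \<forall>i. z $ i * cis (- (2 * pi * b $ i)) \<notin> \<real>\<^sub>\<le>\<^sub>0}"
  then obtain x where x: "z = torus_map x"
    and nonpos: "\<And>i. z $ i * cis (- (2 * pi * b $ i)) \<notin> \<real>\<^sub>\<le>\<^sub>0" by (auto simp: torus_def)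
  have "\<bar>Arg (z $ i * cis (- (2 * pi * b $ i)))\<bar> < pi" for i
    using nonpos by (rule abs_Arg_less_pi)
  then have "torus_coord b z \<in> unit_box b"
    by (simp add: unit_box_def torus_coord_def field_simps)
  moreover have "torus_map (torus_coord b z) = z"
  proof -
    have "cis (2 * pi * torus_coord b z $ i) = z $ i" for i
    proof -
      let ?w = "z $ i * cis (- (2 * pi * b $ i))"
      have w: "?w = cis (2 * pi * (x $ i - b $ i))" unfolding x by (rule torus_map_nth_mult)
      have "cis (2 * pi * torus_coord b z $ i) = cis (2 * pi * b $ i) * cis (Arg ?w)"
        by (simp add: torus_coord_def cis_mult distrib_left)
      \<comment> \<open>Components of torus points have modulus 1, so \<open>cis\<close> undoes
        \<open>Arg\<close> on them.\<close>
      also have "cis (Arg ?w) = ?w" unfolding w by (simp add: cis_Arg sgn_eq)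
      also have "cis (2 * pi * b $ i) * ?w = z $ i"
        using cis_mult[of "2 * pi * b $ i" "- (2 * pi * b $ i)"] by (simp add: mult_ac)
      finally show ?thesis .
    qed
    then show ?thesis by (simp add: torus_map_def vec_eq_iff)
  qed
  ultimately show "z \<in> torus_map ` unit_box b" by (metis imageI)
qed

lemma continuous_torus_map: "continuous_on S torus_map"
  unfolding torus_map_def by (intro continuous_intros)

lemma openin_torus_map_unit_box:
  fixes b :: "real ^ 'n::finite"
  shows "openin (top_of_set torus) (torus_map ` unit_box b)"
proof -
  have "open (\<Inter>i. (\<lambda>z :: complex ^ 'n. z $ i * cis (- (2 * pi * b $ i))) -` (- \<real>\<^sub>\<le>\<^sub>0))"
    by (intro open_INT open_vimage ballI continuous_intros) auto
  moreover have "torus_map ` unit_box b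
      = torus \<inter> (\<Inter>i. (\<lambda>z. z $ i * cis (- (2 * pi * b $ i))) -` (- \<real>\<^sub>\<le>\<^sub>0))"
    unfolding torus_map_unit_box_eq by auto
  ultimately show ?thesis by (simp only: openin_open_Int)
qed

lemma open_unit_box: "open (unit_box b)"
proof -
  have "unit_box b = (\<Inter>i. {x. \<bar>x $ i - b $ i\<bar> < 1 / 2})" by (auto simp: unit_box_def)
  also have "open \<dots>"
    by (intro open_INT open_Collect_less ballI continuous_intros) auto
  finally show ?thesis .
qed

lemma continuous_torus_coord: "continuous_on (torus_map ` unit_box b) (torus_coord b)"
  unfolding torus_coord_def torus_map_unit_box_eq
  by (intro continuous_intros) auto

lemma coords_torus_chart: "coords (torus_chart b) = unit_box b"
  by (auto simp: coords_def torus_chart_def torus_coord_torus_map image_image)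

lemma param_torus_chart:
  assumes "x \<in> unit_box b"
  shows "param (torus_chart b) x = torus_map x"
proof -
  have "inj_on (torus_coord b) (torus_map ` unit_box b)"
    by (auto simp: inj_on_def torus_coord_torus_map)
  then have "inv_into (torus_map ` unit_box b) (torus_coord b) (torus_coord b (torus_map x)) = torus_map x"
    using assms by (intro inv_into_f_f) auto
  then show ?thesis
    by (simp add: param_def torus_chart_def torus_coord_torus_map[OF assms])
qed

lemma fst_torus_chart: "fst (torus_chart b) = torus_map ` unit_box b"
  and snd_torus_chart: "snd (torus_chart b) = torus_coord b"
  by (simp_all add: torus_chart_def)

text \<open>Two lifts of a point differ by an integer vector, and translation by it is the
  transition map near that point. The vector may change between components of the overlap, so the
  statement is local.\<close>

lemma transition_torus_chart:
  assumes "x \<in> unit_box b" "torus_map x \<in> torus_map ` unit_box b'"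
  shows "(transition (torus_chart b) (torus_chart b') has_derivative (\<lambda>v. v)) (at x)"
proof -
  obtain y where y: "y \<in> unit_box b'" "torus_map y = torus_map x" using assms(2) by auto
  define m where "m = y - x"
  have m: "\<And>i. m $ i \<in> \<int>" using y(2) by (simp add: m_def torus_map_eq_iff)
  let ?U = "unit_box b \<inter> (\<lambda>z. z + m) -` unit_box b'"
  have "((\<lambda>z. z + m) has_derivative (\<lambda>v. v)) (at x)"
    by (auto intro!: derivative_eq_intros)
  moreover have "open ?U"
    by (intro open_Int open_vimage open_unit_box continuous_intros)
  moreover have "x \<in> ?U" using assms(1) y(1) by (simp add: m_def)
  moreover have "z + m = transition (torus_chart b) (torus_chart b') z" if "z \<in> ?U" for z
  proof -
    have "torus_map z = torus_map (z + m)" using m by (simp add: torus_map_eq_iff)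
    then show ?thesis
      using that by (simp add: transition_def param_torus_chart torus_coord_torus_map)
        (simp add: torus_chart_def torus_coord_torus_map)
  qed
  ultimately show ?thesis by (rule has_derivative_transform_within_open)
qed

lemma Ck_on_const: "Ck_on k S (\<lambda>_. c)"
proof (induction k arbitrary: c)
  case (Suc k)
  then show ?case by (auto intro!: exI[of _ "\<lambda>_ _. 0"])
qed simp

text \<open>The derivative is constant, so all higher ones vanish; it does not matter which
  translation \<open>f\<close> is on each component of \<open>S\<close>.\<close>

lemma smooth_on_if_derivative_id:
  assumes "\<And>x. x \<in> S \<Longrightarrow> (f has_derivative (\<lambda>v. v)) (at x)"
  shows "smooth_on S f"
  unfolding smooth_on_def
proof
  fix k
  show "Ck_on k S f"
  proof (cases k)
    case 0
    then show ?thesis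
      using assms by (auto intro!: continuous_at_imp_continuous_on has_derivative_continuous)
  next
    case (Suc k')
    then show ?thesis
      using assms by (auto intro!: exI[of _ "\<lambda>_ v. v"] Ck_on_const)
  qed
qed

lemma torus_map_surj_unit_cell:
  obtains y where "y \<in> unit_cell b" "torus_map y = torus_map x"
proof
  let ?y = "\<chi> i. x $ i - \<lfloor>x $ i - b $ i + 1 / 2\<rfloor>"
  show "torus_map ?y = torus_map x" by (simp add: torus_map_eq_iff)
  have "b $ i - 1 / 2 \<le> ?y $ i \<and> ?y $ i < b $ i + 1 / 2" for i
    using floor_correct[of "x $ i - b $ i + 1 / 2"] by simp linarith
  then show "?y \<in> unit_cell b" by (simp add: unit_cell_def)
qed

lemma smooth_atlas_torus: "smooth_atlas (top_of_set torus) (range (torus_chart :: _ \<Rightarrow> (complex ^ 'n::finite, 'n) chart))"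
  unfolding smooth_atlas_def
proof (intro conjI ballI)
  have "torus_map x \<in> torus_map ` unit_box x" for x :: "real ^ 'n"
    by (auto simp: unit_box_def)
  then have "(\<Union>b. torus_map ` unit_box b) = (torus :: (complex ^ 'n) set)"
    unfolding torus_def by blast
  then show "(\<Union>c\<in>range torus_chart. fst c) = topspace (top_of_set (torus :: (complex ^ 'n) set))"
    by (simp add: torus_chart_def)
next
  fix c :: "(complex ^ 'n, 'n) chart" assume "c \<in> range torus_chart"
  then obtain b where c: "c = torus_chart b" by auto
  have sub: "torus_map ` unit_box b \<subseteq> torus" by (auto simp: torus_def)
  have fst: "fst c = torus_map ` unit_box b" and snd: "snd c = torus_coord b"
    by (simp_all add: c torus_chart_def)
  show "openin (top_of_set torus) (fst c)"
    unfolding fst by (rule openin_torus_map_unit_box)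
  show "open (coords c)"
    unfolding c coords_torus_chart by (rule open_unit_box)
  have "homeomorphic_maps (top_of_set (torus_map ` unit_box b)) (top_of_set (unit_box b)) (torus_coord b) torus_map"
    by (auto simp: homeomorphic_maps_def continuous_torus_map continuous_torus_coord torus_coord_torus_map)
  moreover have "subtopology (top_of_set torus) (fst c) = top_of_set (torus_map ` unit_box b)"
    unfolding fst using sub by (simp add: subtopology_subtopology Int_absorb1)
  ultimately show "homeomorphic_map (subtopology (top_of_set torus) (fst c)) (top_of_set (coords c)) (snd c)"
    unfolding homeomorphic_map_maps snd coords_torus_chart[of b, folded c] by metis
next
  fix c c' :: "(complex ^ 'n, 'n) chart" assume "c \<in> range torus_chart" "c' \<in> range torus_chart"
  then obtain b b' where c: "c = torus_chart b" "c' = torus_chart b'" by auto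
  show "smooth_on (snd c ` (fst c \<inter> fst c')) (transition c c')"
  proof (rule smooth_on_if_derivative_id)
    fix x assume "x \<in> snd c ` (fst c \<inter> fst c')"
    then obtain y where y: "y \<in> unit_box b" "torus_map y \<in> torus_map ` unit_box b'"
      and "x = torus_coord b (torus_map y)"
      by (auto simp: c fst_torus_chart snd_torus_chart)
    then have "x = y" by (simp add: torus_coord_torus_map)
    then show "(transition c c' has_derivative (\<lambda>v. v)) (at x)"
      unfolding c using y by (simp add: transition_torus_chart)
  qed
qed

lemma smooth_metric_torus:
  "smooth_metric (range (torus_chart :: _ \<Rightarrow> (complex ^ 'n::finite, 'n) chart)) (\<lambda>_ _. mat 1)"
  unfolding smooth_metric_def
proof (intro conjI ballI)
  fix c c' :: "(complex ^ 'n, 'n) chart" and p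
  assume "c \<in> range torus_chart" "c' \<in> range torus_chart" and p: "p \<in> fst c \<inter> fst c'"
  then obtain b b' where c: "c = torus_chart b" "c' = torus_chart b'" by auto
  have "(transition c c' has_derivative (\<lambda>v. v)) (at (snd c p))"
  proof -
    obtain x where x: "x \<in> unit_box b" "p = torus_map x" using p by (auto simp: c torus_chart_def)
    then have "snd c p = x" by (simp add: c torus_chart_def torus_coord_torus_map)
    then show ?thesis
      using transition_torus_chart[OF x(1)] p by (simp add: c x(2) torus_chart_def)
  qed
  then have "frechet_derivative (transition c c') (at (snd c p)) = (\<lambda>v. v)"
    by (metis frechet_derivative_at)
  then show "let J = matrix (frechet_derivative (transition c c') (at (snd c p)))
      in mat 1 = transpose J ** mat 1 ** J"
    by (simp add: Let_def transpose_mat matrix_id_mat_1 flip: id_def)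
qed (auto simp: smooth_on_def Ck_on_const transpose_mat)

lemma torus_eq_image: "torus = torus_map ` cbox (\<chi> i. - 1 / 2) (\<chi> i. 1 / 2)"
proof
  show "torus \<subseteq> torus_map ` cbox (\<chi> i. - 1 / 2) (\<chi> i. 1 / 2)"
  proof
    fix z :: "complex ^ 'n" assume "z \<in> torus"
    then obtain x where x: "z = torus_map x" by (auto simp: torus_def)
    obtain y where "y \<in> unit_cell 0" "torus_map y = torus_map x"
      by (rule torus_map_surj_unit_cell)
    then show "z \<in> torus_map ` cbox (\<chi> i. - 1 / 2) (\<chi> i. 1 / 2)"
      by (intro image_eqI[of _ _ y]) (auto simp: x mem_box_cart unit_cell_def less_imp_le)
  qed
qed (auto simp: torus_def)

lemma compact_riemannian_manifold_flat_torus: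
  "compact_riemannian_manifold (flat_torus :: (complex ^ 'n, 'n::finite) riemannian)"
proof -
  have "compactin euclidean (torus :: (complex ^ 'n) set)"
    unfolding torus_eq_image compactin_euclidean_iff
    by (intro compact_continuous_image continuous_torus_map compact_cbox)
  moreover have "connectedin euclidean (torus :: (complex ^ 'n) set)"
    unfolding torus_def connectedin_iff_connected
    by (intro connected_continuous_image continuous_torus_map connected_UNIV)
  moreover have "(torus :: (complex ^ 'n) set) \<noteq> {}" by (simp add: torus_def)
  moreover have "Hausdorff_space (top_of_set (torus :: (complex ^ 'n) set))"
    by (intro Hausdorff_space_subtopology Hausdorff_space_euclidean)
  ultimately show ?thesis
    using smooth_atlas_torus[where 'n = 'n] smooth_metric_torus[where 'n = 'n]
    unfolding compact_riemannian_manifold_def flat_torus_def riemannian.simps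
    by (intro conjI compact_space_subtopology connected_space_subtopology) simp_all
qed

section \<open>The normalized volume of the torus\<close>

lemma borel_unit_cell [measurable]: "unit_cell b \<in> sets borel"
proof -
  have "unit_cell b = (\<Inter>i. {x. b $ i - 1 / 2 \<le> x $ i} \<inter> {x. x $ i < b $ i + 1 / 2})"
    by (auto simp: unit_cell_def)
  also have "\<dots> \<in> sets borel"
    by (intro sets.finite_INT sets.Int borel_closed borel_open closed_Collect_le open_Collect_less
      continuous_intros) auto
  finally show ?thesis .
qed

lemma unit_cell_eqI:
  assumes "x \<in> unit_cell b" "y \<in> unit_cell b" "torus_map x = torus_map y"
  shows "x = y"
proof -
  have "x $ i = y $ i" for i
  proof -
    obtain n :: int where n: "x $ i - y $ i = of_int n"
      using assms(3) by (auto simp: torus_map_eq_iff Ints_def)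
    have "\<bar>x $ i - y $ i\<bar> < 1"
    proof -
      have "b $ i - 1 / 2 \<le> x $ i \<and> x $ i < b $ i + 1 / 2" "b $ i - 1 / 2 \<le> y $ i \<and> y $ i < b $ i + 1 / 2"
        using assms(1,2) by (auto simp: unit_cell_def)
      then show ?thesis by linarith
    qed
    then have "n = 0" unfolding n by linarith
    then show ?thesis using n by simp
  qed
  then show ?thesis by (simp add: vec_eq_iff)
qed

lemma unit_box_subset_unit_cell: "unit_box b \<subseteq> unit_cell b"
proof
  fix x assume x: "x \<in> unit_box b"
  have "b $ i - 1 / 2 \<le> x $ i \<and> x $ i < b $ i + 1 / 2" for i
  proof -
    have "\<bar>x $ i - b $ i\<bar> < 1 / 2" using x by (auto simp: unit_box_def)
    then show ?thesis by linarith
  qed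
  then show "x \<in> unit_cell b" by (simp add: unit_cell_def)
qed

lemma emeasure_unit_cell: "emeasure lborel (unit_cell b) = 1"
proof -
  let ?l = "\<chi> i. b $ i - 1 / 2" and ?u = "\<chi> i. b $ i + 1 / 2"
  have "(\<Prod>v\<in>Basis. (?u - ?l) \<bullet> v) = 1" "\<forall>v\<in>Basis. ?l \<bullet> v \<le> ?u \<bullet> v"
    by (auto simp: Basis_vec_def inner_axis intro!: prod.neutral)
  then have "emeasure lborel (box ?l ?u) = 1" "emeasure lborel (cbox ?l ?u) = 1"
    by (simp_all add: emeasure_lborel_box_eq emeasure_lborel_cbox_eq)
  moreover have "box ?l ?u \<subseteq> unit_cell b" "unit_cell b \<subseteq> cbox ?l ?u"
    by (auto simp: unit_cell_def mem_box_cart less_imp_le)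
  ultimately show ?thesis
    using emeasure_mono[of "box ?l ?u" "unit_cell b" lborel]
      emeasure_mono[of "unit_cell b" "cbox ?l ?u" lborel]
    by (intro antisym) auto
qed

lemma emeasure_lborel_translation:
  fixes A :: "'a::euclidean_space set"
  assumes "A \<in> sets borel"
  shows "emeasure lborel ((+) c -` A) = emeasure lborel A"
proof -
  have "emeasure lborel A = emeasure (distr lborel borel ((+) c)) A"
    by (simp add: lborel_distr_plus)
  also have "\<dots> = emeasure lborel ((+) c -` A)"
    using assms by (subst emeasure_distr) auto
  finally show ?thesis by simp
qed

text \<open>Both cells are fundamental domains of the lattice, so each can be cut along the lattice
  translates of the other.\<close>

lemma emeasure_periodic_Int_unit_cell:
  fixes b b' :: "real ^ 'n::finite"
  assumes S: "S \<in> sets borel" and periodic: "\<And>x y. torus_map x = torus_map y \<Longrightarrow> x \<in> S \<longleftrightarrow> y \<in> S"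
  shows "emeasure lborel (S \<inter> unit_cell b) = emeasure lborel (S \<inter> unit_cell b')"
proof -
  define v :: "('n \<Rightarrow> int) \<Rightarrow> real ^ 'n" where "v f = (\<chi> i. of_int (f i))" for f
  have v: "torus_map (v f + x) = torus_map x" for f x
    by (simp add: torus_map_eq_iff v_def)
  have split: "emeasure lborel (S \<inter> unit_cell b)
      = (\<integral>\<^sup>+f. emeasure lborel (S \<inter> unit_cell b \<inter> (+) (v f) -` unit_cell b') \<partial>count_space UNIV)"
    for b b' :: "real ^ 'n"
  proof -
    have "\<exists>f. v f + x \<in> unit_cell b'" for x
    proof -
      obtain y where y: "y \<in> unit_cell b'" "torus_map y = torus_map x"
        by (rule torus_map_surj_unit_cell)
      have "\<exists>n :: int. y $ i - x $ i = of_int n" for i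
        using y(2) by (auto simp: torus_map_eq_iff Ints_def)
      then obtain f :: "'n \<Rightarrow> int" where "\<And>i. y $ i - x $ i = of_int (f i)" by metis
      then have "y = v f + x" by (simp add: v_def vec_eq_iff flip: diff_eq_eq)
      then show ?thesis using y(1) by blast
    qed
    then have "S \<inter> unit_cell b = (\<Union>f. S \<inter> unit_cell b \<inter> (+) (v f) -` unit_cell b')"
      by auto
    moreover have "emeasure lborel (\<Union>f. S \<inter> unit_cell b \<inter> (+) (v f) -` unit_cell b')
      = (\<integral>\<^sup>+f. emeasure lborel (S \<inter> unit_cell b \<inter> (+) (v f) -` unit_cell b') \<partial>count_space UNIV)"
    proof (rule emeasure_UN_countable)
      show "S \<inter> unit_cell b \<inter> (+) (v f) -` unit_cell b' \<in> sets lborel" for f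
        using S measurable_sets_borel[of "(+) (v f)" borel "unit_cell b'"] by simp
      show "disjoint_family (\<lambda>f. S \<inter> unit_cell b \<inter> (+) (v f) -` unit_cell b')"
      proof -
        have "f = g" if "v f + x \<in> unit_cell b'" "v g + x \<in> unit_cell b'" for f g x
        proof -
          have "v f + x = v g + x" using that by (rule unit_cell_eqI) (simp add: v)
          then show ?thesis by (simp add: v_def vec_eq_iff fun_eq_iff)
        qed
        then show ?thesis by (auto simp: disjoint_family_on_def)
      qed
    qed simp
    ultimately show ?thesis by (simp only:)
  qed
  \<comment> \<open>Translation by \<open>v f\<close> carries the piece with index \<open>f\<close>
    onto the piece of the other cell with index \<open>- f\<close>, and periodicity preserves
    membership in \<open>S\<close>.\<close>
  have "emeasure lborel (S \<inter> unit_cell b \<inter> (+) (v f) -` unit_cell b')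
      = emeasure lborel (S \<inter> unit_cell b' \<inter> (+) (v (\<lambda>i. - f i)) -` unit_cell b)" for f
  proof -
    have neg: "v (\<lambda>i. - f i) + (v f + x) = x" for x by (simp add: v_def vec_eq_iff)
    have "S \<inter> unit_cell b \<inter> (+) (v f) -` unit_cell b'
        = (+) (v f) -` (S \<inter> unit_cell b' \<inter> (+) (v (\<lambda>i. - f i)) -` unit_cell b)"
      using periodic[OF v] by (auto simp: neg)
    moreover have "(+) (v (\<lambda>i. - f i)) -` unit_cell b \<in> sets borel"
      using measurable_sets_borel[of "(+) (v (\<lambda>i. - f i))" borel "unit_cell b"] by simp
    ultimately show ?thesis
      using S emeasure_lborel_translation[of "S \<inter> unit_cell b' \<inter> (+) (v (\<lambda>i. - f i)) -` unit_cell b" "v f"]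
      by (simp only: sets.Int borel_unit_cell)
  qed
  then have "emeasure lborel (S \<inter> unit_cell b) = (\<integral>\<^sup>+f. emeasure lborel
      (S \<inter> unit_cell b' \<inter> (+) (v (\<lambda>i. - f i)) -` unit_cell b) \<partial>count_space UNIV)"
    by (subst split[of b b']) (rule nn_integral_cong)
  also have "\<dots> = (\<integral>\<^sup>+f. emeasure lborel (S \<inter> unit_cell b' \<inter> (+) (v f) -` unit_cell b) \<partial>count_space UNIV)"
    by (rule nn_integral_bij_count_space) (auto intro!: bij_betwI[of _ _ _ "\<lambda>f i. - f i"])
  also have "\<dots> = emeasure lborel (S \<inter> unit_cell b')" by (rule split[symmetric])
  finally show ?thesis .
qed

text \<open>Centring the cell at 0 puts the minimum of the potential in the middle, so that halving
  the argument stays inside the cell.\<close>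

definition torus_measure :: "(complex ^ 'n::finite) measure" where
  "torus_measure = distr (restrict_space lborel (unit_cell 0)) (borel_of (top_of_set torus)) torus_map"

lemma torus_map_measurable: "torus_map \<in> lborel \<rightarrow>\<^sub>M borel_of (top_of_set torus)"
  unfolding borel_of_def
proof (rule measurable_measure_of)
  fix U :: "(complex ^ 'n) set" assume "U \<in> {U. openin (top_of_set torus) U}"
  then obtain V where V: "open V" "U = torus \<inter> V" by (auto simp: openin_open)
  have "torus_map -` U \<inter> space lborel = torus_map -` V" by (auto simp: V(2) torus_def)
  moreover have "open (torus_map -` V)" using V(1) continuous_torus_map by (rule open_vimage)
  ultimately show "torus_map -` U \<inter> space lborel \<in> sets lborel" by simp
qed (auto simp: torus_def dest: openin_imp_subset)

lemma sets_torus_measure: "sets torus_measure = sets (borel_of (top_of_set torus))"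
  and space_torus_measure: "space torus_measure = torus"
  by (simp_all add: torus_measure_def)

lemma nn_integral_torus_measure:
  assumes "f \<in> borel_measurable (borel_of (top_of_set torus))"
  shows "(\<integral>\<^sup>+z. f z \<partial>torus_measure) = (\<integral>\<^sup>+x\<in>unit_cell 0. f (torus_map x) \<partial>lborel)"
  unfolding torus_measure_def
  using assms by (simp add: nn_integral_distr nn_integral_restrict_space
    measurable_restrict_space1[OF torus_map_measurable])

lemma emeasure_torus_measure:
  assumes "A \<in> sets torus_measure"
  shows "emeasure torus_measure A = emeasure lborel (torus_map -` A \<inter> unit_cell 0)"
proof -
  have "torus_map -` A \<in> sets lborel"
    using measurable_sets[OF torus_map_measurable, of A] assms by (simp add: sets_torus_measure)
  then show ?thesis
    using assms unfolding torus_measure_def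
    by (subst emeasure_distr)
      (auto simp: measurable_restrict_space1[OF torus_map_measurable] space_restrict_space
        emeasure_restrict_space intro!: arg_cong2[where f = emeasure])
qed

text \<open>The metric has determinant 1, so the chart volume is a Lebesgue measure in the cell
  around \<open>b\<close>; \<open>emeasure_periodic_Int_unit_cell\<close> moves it to the cell
  around 0.\<close>

lemma riemannian_volume_torus_measure: "riemannian_volume flat_torus torus_measure"
  unfolding riemannian_volume_def
proof (intro conjI ballI impI)
  show "space torus_measure = topspace (topol flat_torus)"
      "sets torus_measure = sets (borel_of (topol flat_torus))"
    by (simp_all add: space_torus_measure sets_torus_measure flat_torus_def)
  fix c :: "(complex ^ 'n, 'n) chart" and A
  assume "c \<in> atlas flat_torus" and A: "A \<in> sets torus_measure" "A \<subseteq> fst c"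
  then obtain b where c: "c = torus_chart b" by (auto simp: flat_torus_def)
  have S: "torus_map -` A \<in> sets borel"
    using measurable_sets[OF torus_map_measurable, of A] A by (simp add: sets_torus_measure)
  have "snd c ` A = torus_map -` A \<inter> unit_cell b"
  proof (intro set_eqI iffI)
    fix x assume "x \<in> snd c ` A"
    then obtain y where "y \<in> unit_box b" "torus_map y \<in> A" "x = y"
      using A(2) by (force simp: c fst_torus_chart snd_torus_chart torus_coord_torus_map)
    then show "x \<in> torus_map -` A \<inter> unit_cell b" using unit_box_subset_unit_cell by auto
  next
    fix x assume x: "x \<in> torus_map -` A \<inter> unit_cell b"
    then obtain y where y: "y \<in> unit_box b" "torus_map x = torus_map y"
      using A(2) by (auto simp: c fst_torus_chart)
    \<comment> \<open>\<open>A\<close> lies in the chart domain, so a point of the cell over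
      \<open>A\<close> is already in the open box: the faces contribute nothing.\<close>
    then have "x = y" using x unit_box_subset_unit_cell[of b] by (intro unit_cell_eqI[of _ b]) auto
    then show "x \<in> snd c ` A"
      using x y by (auto simp: c snd_torus_chart torus_coord_torus_map intro!: image_eqI[of _ _ "torus_map y"])
  qed
  then have "(\<integral>\<^sup>+x\<in>snd c ` A. ennreal (sqrt (det (metric flat_torus c x))) \<partial>lborel)
      = emeasure lborel (torus_map -` A \<inter> unit_cell b)"
    using S by (simp add: flat_torus_def)
  also have "\<dots> = emeasure torus_measure A"
    unfolding emeasure_torus_measure[OF A(1)]
    by (rule emeasure_periodic_Int_unit_cell[OF S]) auto
  finally show "emeasure torus_measure A
      = (\<integral>\<^sup>+x\<in>snd c ` A. ennreal (sqrt (det (metric flat_torus c x))) \<partial>lborel)" by simp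
qed

lemma emeasure_torus_measure_space:
  "emeasure torus_measure (space torus_measure :: (complex ^ 'n::finite) set) = 1"
proof -
  have "torus_map -` torus = (UNIV :: (real ^ 'n) set)" by (auto simp: torus_def)
  then show ?thesis
    using emeasure_torus_measure[OF sets.top[of "torus_measure :: (complex ^ 'n) measure"]] by (simp add: space_torus_measure emeasure_unit_cell)
qed

lemma normalized_torus_measure: "normalized torus_measure = torus_measure"
  by (simp add: normalized_def emeasure_torus_measure_space)

section \<open>The potential on the torus\<close>

text \<open>On the torus this is half the squared Euclidean distance to the point with all
  components 1, its only zero there.\<close>

definition torus_potential :: "complex ^ 'n::finite \<Rightarrow> real" where
  "torus_potential z = (\<Sum>i\<in>UNIV. 1 - Re (z $ i))"

definition torus_energy :: "real ^ 'n::finite \<Rightarrow> real" where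
  "torus_energy x = torus_potential (torus_map x)"

text \<open>The gradient of \<open>torus_energy\<close>, without the minus sign of a physical
  force.\<close>

definition torus_force :: "real ^ 'n::finite \<Rightarrow> real ^ 'n" where
  "torus_force x = (\<chi> i. 2 * pi * sin (2 * pi * x $ i))"

lemma torus_energy_eq: "torus_energy x = (\<Sum>i\<in>UNIV. 1 - cos (2 * pi * x $ i))"
  by (simp add: torus_energy_def torus_potential_def torus_map_def)

lemma torus_potential_bounds:
  fixes z :: "complex ^ 'n::finite"
  assumes "z \<in> torus"
  shows "0 \<le> torus_potential z \<and> torus_potential z \<le> 2 * real CARD('n)"
proof -
  obtain x where x: "z = torus_map x" using assms by (auto simp: torus_def)
  have "torus_energy x \<le> (\<Sum>i\<in>(UNIV :: 'n set). 2)"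
    unfolding torus_energy_eq by (intro sum_mono) (use cos_ge_minus_one in \<open>smt (verit)\<close>)
  moreover have "0 \<le> torus_energy x"
    unfolding torus_energy_eq by (intro sum_nonneg) simp
  ultimately show ?thesis by (simp add: x torus_energy_def)
qed

lemma continuous_torus_potential: "continuous_on S torus_potential"
  unfolding torus_potential_def by (intro continuous_intros)

lemma torus_energy_has_derivative:
  "(torus_energy has_derivative (\<lambda>v. torus_force x \<bullet> v)) (at x)"
proof -
  have "((\<lambda>x. \<Sum>i\<in>UNIV. 1 - cos (2 * pi * x $ i)) has_derivative
      (\<lambda>v. \<Sum>i\<in>UNIV. 2 * pi * v $ i * sin (2 * pi * x $ i))) (at x)"
    by (auto intro!: derivative_eq_intros bounded_linear_imp_has_derivative bounded_linear_vec_nth sum.cong)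
  then show ?thesis
    by (simp add: torus_force_def inner_vec_def torus_energy_eq[abs_def] mult_ac)
qed

lemma norm_torus_force_le: "norm (torus_force x) \<le> 2 * pi * real CARD('n)"
  for x :: "real ^ 'n::finite"
proof -
  have "norm (torus_force x) \<le> (\<Sum>i\<in>UNIV. \<bar>torus_force x $ i\<bar>)" by (rule norm_le_l1_cart)
  also have "\<dots> \<le> (\<Sum>i\<in>(UNIV :: 'n set). 2 * pi)"
    by (intro sum_mono) (simp add: torus_force_def abs_mult)
  finally show ?thesis by (simp add: mult.commute)
qed

lemma abs_sin_diff_le: "\<bar>sin a - sin b\<bar> \<le> \<bar>a - b\<bar>" for a b :: real
proof -
  have "\<bar>sin a - sin b\<bar> = 2 * \<bar>sin ((a - b) / 2)\<bar> * \<bar>cos ((a + b) / 2)\<bar>"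
    by (simp add: sin_diff_sin abs_mult)
  also have "\<dots> \<le> 2 * \<bar>(a - b) / 2\<bar> * 1"
    by (intro mult_mono mult_left_mono abs_sin_x_le_abs_x) auto
  finally show ?thesis by simp
qed

lemma torus_force_lipschitz:
  "norm (torus_force x - torus_force y) \<le> (2 * pi)\<^sup>2 * norm (x - y)"
proof -
  have "norm (torus_force x - torus_force y) \<le> norm ((2 * pi)\<^sup>2 *\<^sub>R (x - y))"
  proof (rule norm_le_componentwise_cart)
    fix i
    have "\<bar>2 * pi * sin (2 * pi * x $ i) - 2 * pi * sin (2 * pi * y $ i)\<bar>
        = 2 * pi * \<bar>sin (2 * pi * x $ i) - sin (2 * pi * y $ i)\<bar>"
      by (simp add: abs_mult flip: right_diff_distrib)
    also have "\<dots> \<le> 2 * pi * \<bar>2 * pi * x $ i - 2 * pi * y $ i\<bar>"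
      by (intro mult_left_mono abs_sin_diff_le) simp
    also have "\<dots> = (2 * pi)\<^sup>2 * \<bar>x $ i - y $ i\<bar>"
      by (simp add: abs_mult power2_eq_square flip: right_diff_distrib)
    finally show "norm ((torus_force x - torus_force y) $ i) \<le> norm (((2 * pi)\<^sup>2 *\<^sub>R (x - y)) $ i)"
      by (simp add: torus_force_def abs_mult)
  qed
  then show ?thesis by simp
qed

text \<open>In every chart the potential has the same coordinate expression
  \<open>torus_energy\<close>, whose gradient is globally Lipschitz; hence one formula for
  \<open>D\<close> and the radius 1 serve everywhere.\<close>

lemma lipschitz_derivative_torus_potential:
  fixes e :: "'f::real_normed_vector"
  shows "lipschitz_derivative_map (flat_torus :: (complex ^ 'n, 'n::finite) riemannian)
    (\<lambda>z. torus_potential z *\<^sub>R e)"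
  unfolding lipschitz_derivative_map_def
proof
  fix c :: "(complex ^ 'n, 'n) chart" assume "c \<in> atlas flat_torus"
  then obtain b where c: "c = torus_chart b" by (auto simp: flat_torus_def)
  define D :: "real ^ 'n \<Rightarrow> (real ^ 'n) \<Rightarrow>\<^sub>L 'f" where
    "D x = blinfun_scaleR_left e o\<^sub>L blinfun_inner_left (torus_force x)" for x
  have D: "blinfun_apply (D x) v = (torus_force x \<bullet> v) *\<^sub>R e" for x v
    by (simp add: D_def inner_commute)
  have "((\<lambda>z. torus_potential z *\<^sub>R e) \<circ> param c has_derivative blinfun_apply (D x)) (at x)"
    if "x \<in> unit_box b" for x
  proof (rule has_derivative_transform_within_open[OF _ open_unit_box that])
    show "((\<lambda>x. torus_energy x *\<^sub>R e) has_derivative blinfun_apply (D x)) (at x)"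
      unfolding D[abs_def] by (auto intro!: derivative_eq_intros torus_energy_has_derivative)
  qed (simp add: c param_torus_chart torus_energy_def)
  moreover have "((2 * pi)\<^sup>2 * norm e)-lipschitz_on S D" for S
  proof (rule lipschitz_onI)
    fix x y
    have "norm (D x - D y) \<le> (2 * pi)\<^sup>2 * norm e * norm (x - y)"
    proof (rule norm_blinfun_bound)
      fix v
      have "norm ((D x - D y) v) = \<bar>(torus_force x - torus_force y) \<bullet> v\<bar> * norm e"
        by (simp add: minus_blinfun.rep_eq D inner_diff_left flip: scaleR_left_diff_distrib)
      also have "\<dots> \<le> (norm (torus_force x - torus_force y) * norm v) * norm e"
        by (intro mult_right_mono Cauchy_Schwarz_ineq2) simp
      also have "\<dots> \<le> ((2 * pi)\<^sup>2 * norm (x - y) * norm v) * norm e"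
        by (intro mult_right_mono torus_force_lipschitz) simp_all
      finally show "norm ((D x - D y) v) \<le> (2 * pi)\<^sup>2 * norm e * norm (x - y) * norm v"
        by (simp add: mult_ac)
    qed simp
    then show "dist (D x) (D y) \<le> (2 * pi)\<^sup>2 * norm e * dist x y" by (simp add: dist_norm)
  qed simp
  ultimately show "\<exists>D. \<forall>x\<in>coords c.
      ((\<lambda>z. torus_potential z *\<^sub>R e) \<circ> param c has_derivative blinfun_apply (D x)) (at x) \<and>
      (\<exists>\<epsilon>>0. \<exists>L. L-lipschitz_on (ball x \<epsilon> \<inter> coords c) D)"
    unfolding c coords_torus_chart by (intro exI[of _ D]) (blast intro: zero_less_one)
qed

section \<open>Lipschitz continuity in the geodesic distance\<close>

lemma has_integral_le_nn_integral:
  fixes f :: "real \<Rightarrow> real"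
  assumes "(f has_integral I) S"
  shows "ennreal \<bar>I\<bar> \<le> (\<integral>\<^sup>+t\<in>S. ennreal \<bar>f t\<bar> \<partial>lborel)"
proof (cases "(\<integral>\<^sup>+t\<in>S. ennreal \<bar>f t\<bar> \<partial>lborel) = top")
  \<comment> \<open>A finite right side makes \<open>f\<close> absolutely integrable, so its gauge
    integral is a Lebesgue integral. The completion is used because \<open>f\<close> is only known
    to be Lebesgue measurable.\<close>
  case False
  let ?g = "\<lambda>t. indicator S t *\<^sub>R f t"
  have eq: "(\<integral>\<^sup>+t. ennreal (norm (?g t)) \<partial>lebesgue) = (\<integral>\<^sup>+t\<in>S. ennreal \<bar>f t\<bar> \<partial>lborel)"
    unfolding nn_integral_completion by (intro nn_integral_cong) (auto split: split_indicator)
  have g: "integrable lebesgue ?g"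
    using has_integral_implies_lebesgue_measurable[OF assms] False eq
    by (intro integrableI_bounded) (auto simp: less_top)
  have "(?g has_integral I) UNIV"
  proof -
    have "?g = (\<lambda>t. if t \<in> S then f t else 0)" by (auto simp: fun_eq_iff)
    then show ?thesis using assms by (simp only: has_integral_restrict_UNIV)
  qed
  then have "integral\<^sup>L lebesgue ?g = I"
    using has_integral_integral_lebesgue[OF g] by (rule has_integral_unique[rotated])
  then show ?thesis
    using integral_norm_bound_ennreal[OF g] eq by simp
qed simp

text \<open>\<open>speed\<close> uses an arbitrarily chosen chart. The transition to it has the
  identity as derivative, so the velocity there is still \<open>v\<close>, and the identity metric
  measures it by \<open>norm\<close>.\<close>

lemma speed_flat_torus:
  assumes x: "((\<lambda>s. torus_coord b (\<gamma> s)) has_vector_derivative v) (at t)"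
    and I: "open I" "t \<in> I" "\<gamma> ` I \<subseteq> torus_map ` unit_box b"
  shows "speed flat_torus \<gamma> t = norm v"
proof -
  define c where "c = (SOME c. c \<in> atlas flat_torus \<and> \<gamma> t \<in> fst c)"
  have "torus_chart b \<in> atlas flat_torus \<and> \<gamma> t \<in> fst (torus_chart b)"
    using I by (auto simp: flat_torus_def fst_torus_chart)
  then have "c \<in> atlas flat_torus \<and> \<gamma> t \<in> fst c" unfolding c_def by (rule someI)
  then obtain b' where b': "c = torus_chart b'" "\<gamma> t \<in> torus_map ` unit_box b'"
    by (auto simp: flat_torus_def fst_torus_chart)
  let ?T = "transition (torus_chart b) (torus_chart b')" and ?x = "\<lambda>s. torus_coord b (\<gamma> s)"
  have x_in: "?x s \<in> unit_box b" "torus_map (?x s) = \<gamma> s" if "s \<in> I" for s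
    using I(3) that by (auto simp: torus_coord_torus_map image_subset_iff)
  have "(?T has_derivative (\<lambda>v. v)) (at (?x t))"
    using x_in[OF I(2)] b' by (intro transition_torus_chart) auto
  then have "((\<lambda>s. ?T (?x s)) has_derivative (\<lambda>h. h *\<^sub>R v)) (at t)"
    using has_derivative_compose[OF x[unfolded has_vector_derivative_def]] by blast
  then have "(snd c \<circ> \<gamma> has_derivative (\<lambda>h. h *\<^sub>R v)) (at t)"
    by (rule has_derivative_transform_within_open[OF _ I(1,2)])
      (simp add: transition_def x_in param_torus_chart b')
  then have "vector_derivative (snd c \<circ> \<gamma>) (at t) = v"
    by (intro vector_derivative_at) (simp add: has_vector_derivative_def)
  then show ?thesis
    unfolding speed_def c_def[symmetric] Let_def
    by (simp add: flat_torus_def norm_eq_sqrt_inner)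
qed

text \<open>Within one chart the curve lifts to Euclidean space and the potential is
  \<open>torus_energy\<close> of the lift: the chain rule gives the derivative, and Cauchy-Schwarz
  bounds it by the speed.\<close>

lemma torus_potential_along_curve_local:
  fixes \<gamma> :: "real \<Rightarrow> complex ^ 'n::finite"
  defines "h \<equiv> torus_potential \<circ> \<gamma>"
  assumes \<gamma>: "piecewise_C1_curve flat_torus \<gamma>" and ab: "0 \<le> a" "a \<le> b" "b \<le> 1"
    and sub: "\<gamma> ` {a..b} \<subseteq> torus_map ` unit_box \<beta>"
  shows "((\<lambda>t. vector_derivative h (at t)) has_integral h b - h a) {a..b} \<and>
    (\<exists>S. finite S \<and> (\<forall>t\<in>{a..b} - S.
      \<bar>vector_derivative h (at t)\<bar> \<le> 2 * pi * real CARD('n) * speed flat_torus \<gamma> t))"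
proof -
  let ?x = "torus_coord \<beta> \<circ> \<gamma>"
  have "torus_chart \<beta> \<in> atlas flat_torus" by (simp add: flat_torus_def)
  then have "?x piecewise_C1_differentiable_on {a..b}"
    using \<gamma> ab sub unfolding piecewise_C1_curve_def by (metis fst_torus_chart snd_torus_chart)
  then obtain S where cont: "continuous_on {a..b} ?x" and S: "finite S"
    and C1: "?x C1_differentiable_on ({a..b} - S)"
    by (auto simp: piecewise_C1_differentiable_on_def)
  obtain x' where x': "\<And>t. t \<in> {a..b} - S \<Longrightarrow> (?x has_vector_derivative x' t) (at t)"
    using C1 unfolding C1_differentiable_on_def by blast
  have "torus_map (?x t) = \<gamma> t" if "t \<in> {a..b}" for t
  proof -
    obtain y where "y \<in> unit_box \<beta>" "\<gamma> t = torus_map y" using sub \<open>t \<in> {a..b}\<close> by blast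
    then show ?thesis by (simp add: torus_coord_torus_map)
  qed
  then have h: "h t = torus_energy (?x t)" if "t \<in> {a..b}" for t
    using that by (simp add: h_def torus_energy_def)
  have dh: "(h has_vector_derivative torus_force (?x t) \<bullet> x' t) (at t)" if "t \<in> {a<..<b} - S" for t
  proof -
    have t: "t \<in> {a..b} - S" "t \<in> {a<..<b}" using that by auto
    have "((\<lambda>s. torus_energy (?x s)) has_derivative (\<lambda>k. torus_force (?x t) \<bullet> (k *\<^sub>R x' t))) (at t)"
      by (rule has_derivative_compose[OF x'[OF t(1), unfolded has_vector_derivative_def] torus_energy_has_derivative])
    then have "((\<lambda>s. torus_energy (?x s)) has_vector_derivative torus_force (?x t) \<bullet> x' t) (at t)"
      by (simp add: has_vector_derivative_def)
    then show ?thesis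
      by (rule has_vector_derivative_transform_within_open[of _ _ _ "{a<..<b}"]) (use t in \<open>auto simp: h\<close>)
  qed
  have "continuous_on {a..b} (\<lambda>t. torus_energy (?x t))"
  proof (rule continuous_on_compose2[OF _ cont])
    show "continuous_on UNIV torus_energy"
      using torus_energy_has_derivative by (rule has_derivative_continuous_on)
  qed simp
  then have cont_h: "continuous_on {a..b} h" by (rule continuous_on_eq) (simp add: h)
  have "((\<lambda>t. vector_derivative h (at t)) has_integral h b - h a) {a..b}"
  proof (rule fundamental_theorem_of_calculus_interior_strong[OF S ab(2)])
    fix t assume "t \<in> {a<..<b} - S"
    note dh[OF this]
    moreover from this have "vector_derivative h (at t) = torus_force (?x t) \<bullet> x' t"
      by (rule vector_derivative_at)
    ultimately show "(h has_vector_derivative vector_derivative h (at t)) (at t)" by simp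
  qed (rule cont_h)
  \<comment> \<open>The end points join the exceptional set because the lift represents the curve
    only on \<open>{a..b}\<close>, which is not a neighbourhood of them.\<close>
  moreover have "\<bar>vector_derivative h (at t)\<bar> \<le> 2 * pi * real CARD('n) * speed flat_torus \<gamma> t"
    if "t \<in> {a..b} - (S \<union> {a, b})" for t
  proof -
    have t: "t \<in> {a<..<b} - S" "t \<in> {a..b} - S" using that by auto
    have "\<bar>vector_derivative h (at t)\<bar> = \<bar>torus_force (?x t) \<bullet> x' t\<bar>"
      using vector_derivative_at[OF dh[OF t(1)]] by simp
    also have "\<dots> \<le> norm (torus_force (?x t)) * norm (x' t)" by (rule Cauchy_Schwarz_ineq2)
    also have "\<dots> \<le> 2 * pi * real CARD('n) * norm (x' t)"
      by (intro mult_right_mono norm_torus_force_le) simp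
    also have "norm (x' t) = speed flat_torus \<gamma> t"
      using x'[OF t(2)] t sub
      by (intro speed_flat_torus[symmetric, of \<beta> _ _ _ "{a<..<b}"]) (auto simp: comp_def)
    finally show ?thesis .
  qed
  ultimately show ?thesis using S by (metis finite.emptyI finite.insertI finite_UnI)
qed

text \<open>A curve need not stay in one chart, but the property passes to adjoining intervals and
  holds on short ones, so the bisection principle \<open>Bolzano\<close> yields it on
  \<open>{0..1}\<close>.\<close>

lemma torus_potential_along_curve:
  fixes \<gamma> :: "real \<Rightarrow> complex ^ 'n::finite"
  defines "h \<equiv> torus_potential \<circ> \<gamma>"
  assumes \<gamma>: "piecewise_C1_curve flat_torus \<gamma>"
  shows "((\<lambda>t. vector_derivative h (at t)) has_integral h 1 - h 0) {0..1} \<and>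
    (\<exists>S. finite S \<and> (\<forall>t\<in>{0..1} - S.
      \<bar>vector_derivative h (at t)\<bar> \<le> 2 * pi * real CARD('n) * speed flat_torus \<gamma> t))"
proof -
  let ?Q = "\<lambda>a b. ((\<lambda>t. vector_derivative h (at t)) has_integral h b - h a) {a..b} \<and>
    (\<exists>S. finite S \<and> (\<forall>t\<in>{a..b} - S.
      \<bar>vector_derivative h (at t)\<bar> \<le> 2 * pi * real CARD('n) * speed flat_torus \<gamma> t))"
  \<comment> \<open>\<open>Bolzano\<close> asks for the property on all short intervals around
    \<open>t\<close>, including those that leave \<open>{0..1}\<close>; the guard makes
    \<open>P\<close> vacuous on these.\<close>
  define P where "P a b \<longleftrightarrow> (0 \<le> a \<longrightarrow> b \<le> 1 \<longrightarrow> ?Q a b)" for a b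
  have "P 0 1"
  proof (rule Bolzano[of 0 1 P])
    fix a b c assume trans: "P a b" "P b c" "a \<le> b" "b \<le> c"
    show "P a c"
      unfolding P_def
    proof (intro impI)
      assume "0 \<le> a" "c \<le> 1"
      then have ab: "?Q a b" and bc: "?Q b c" using trans unfolding P_def
        by (meson order_trans)+
      have "((\<lambda>t. vector_derivative h (at t)) has_integral (h b - h a) + (h c - h b)) {a..c}"
        using trans ab bc by (intro has_integral_combine[of a b c]) auto
      moreover obtain S T where "finite S" "finite T"
        "\<forall>t\<in>{a..b} - S. \<bar>vector_derivative h (at t)\<bar> \<le> 2 * pi * real CARD('n) * speed flat_torus \<gamma> t"
        "\<forall>t\<in>{b..c} - T. \<bar>vector_derivative h (at t)\<bar> \<le> 2 * pi * real CARD('n) * speed flat_torus \<gamma> t"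
        using ab bc by blast
      then have "finite (S \<union> T) \<and> (\<forall>t\<in>{a..c} - (S \<union> T).
          \<bar>vector_derivative h (at t)\<bar> \<le> 2 * pi * real CARD('n) * speed flat_torus \<gamma> t)"
        by (metis DiffD1 DiffD2 DiffI UnI1 UnI2 atLeastAtMost_iff finite_UnI linear)
      ultimately show "?Q a c" by (intro conjI exI[of _ "S \<union> T"]) simp_all
    qed
  next
    fix t :: real assume t: "0 \<le> t" "t \<le> 1"
    have cont: "continuous_map (top_of_set {0..1}) (top_of_set torus) \<gamma>"
      using \<gamma> by (simp add: piecewise_C1_curve_def flat_torus_def)
    then have "\<gamma> t \<in> torus"
      using t by (auto simp: continuous_map_def)
    then obtain \<beta> where "\<gamma> t = torus_map \<beta>" by (auto simp: torus_def)
    then have \<beta>: "\<gamma> t \<in> torus_map ` unit_box \<beta>" by (auto simp: unit_box_def)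
    have "openin (top_of_set {0..1}) {s \<in> {0..1}. \<gamma> s \<in> torus_map ` unit_box \<beta>}"
      using openin_continuous_map_preimage[OF cont openin_torus_map_unit_box] by simp
    then obtain d where d: "d > 0" "\<And>s. s \<in> {0..1} \<Longrightarrow> dist s t < d \<Longrightarrow> \<gamma> s \<in> torus_map ` unit_box \<beta>"
    proof -
      have "t \<in> {s \<in> {0..1}. \<gamma> s \<in> torus_map ` unit_box \<beta>}" using t \<beta> by simp
      with \<open>openin _ _\<close> show ?thesis
        unfolding openin_euclidean_subtopology_iff using that by (metis (no_types, lifting) mem_Collect_eq)
    qed
    have "?Q a b" if "a \<le> t" "t \<le> b" "b - a < d" "0 \<le> a" "b \<le> 1" for a b
      unfolding h_def
    proof (rule torus_potential_along_curve_local[OF \<gamma>, of a b \<beta>])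
      show "\<gamma> ` {a..b} \<subseteq> torus_map ` unit_box \<beta>"
        using that by (intro image_subsetI d(2)) (auto simp: dist_real_def)
    qed (use that in auto)
    then show "\<exists>d>0. \<forall>a b. a \<le> t \<and> t \<le> b \<and> b - a < d \<longrightarrow> P a b"
      using d(1) unfolding P_def by blast
  qed simp
  then show ?thesis by (simp add: P_def)
qed

text \<open>It suffices to bound the length of every curve from below by a multiple of the change of
  the potential along it, so no geodesics have to be found.\<close>

lemma lipschitz_torus_potential:
  fixes e :: "'f::real_normed_vector"
  assumes "norm e = 1"
  shows "lipschitz_map (flat_torus :: (complex ^ 'n, 'n::finite) riemannian) (\<lambda>z. torus_potential z *\<^sub>R e)"
  unfolding lipschitz_map_def
proof (intro exI[of _ "2 * pi * real CARD('n)"] conjI ballI)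
  fix p q :: "complex ^ 'n"
  let ?L = "2 * pi * real CARD('n)"
  have L: "?L > 0" by simp
  let ?\<Delta> = "\<bar>torus_potential q - torus_potential p\<bar>"
  have "ennreal (?\<Delta> / ?L) \<le> geodesic_dist flat_torus p q"
    unfolding geodesic_dist_def
  proof (rule INF_greatest)
    fix \<gamma> assume "\<gamma> \<in> {\<gamma>. piecewise_C1_curve flat_torus \<gamma> \<and> \<gamma> 0 = p \<and> \<gamma> 1 = q}"
    then have \<gamma>: "piecewise_C1_curve flat_torus \<gamma>" "\<gamma> 0 = p" "\<gamma> 1 = q" by auto
    define h' where "h' t = vector_derivative (torus_potential \<circ> \<gamma>) (at t)" for t
    obtain S where int: "(h' has_integral torus_potential q - torus_potential p) {0..1}"
      and S: "finite S" "\<And>t. t \<in> {0..1} - S \<Longrightarrow> \<bar>h' t\<bar> \<le> ?L * speed flat_torus \<gamma> t"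
      using torus_potential_along_curve[OF \<gamma>(1)] \<gamma>(2,3) unfolding h'_def[abs_def] by auto
    \<comment> \<open>Dividing under the integral avoids pulling a constant out of the integral of
      \<open>speed\<close>, which would call for its measurability.\<close>
    have "((\<lambda>t. h' t / ?L) has_integral (torus_potential q - torus_potential p) / ?L) {0..1}"
      using has_integral_divide[OF int] .
    then have "ennreal \<bar>(torus_potential q - torus_potential p) / ?L\<bar>
        \<le> (\<integral>\<^sup>+t\<in>{0..1}. ennreal \<bar>h' t / ?L\<bar> \<partial>lborel)"
      by (rule has_integral_le_nn_integral)
    then have "ennreal (?\<Delta> / ?L) \<le> (\<integral>\<^sup>+t\<in>{0..1}. ennreal \<bar>h' t / ?L\<bar> \<partial>lborel)"
      by (simp only: abs_divide abs_of_pos[OF L])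
    also have "\<dots> \<le> (\<integral>\<^sup>+t\<in>{0..1}. ennreal (speed flat_torus \<gamma> t) \<partial>lborel)"
    proof (rule nn_integral_mono_AE)
      have "AE t in lborel. t \<notin> S" by (rule AE_not_in[OF finite_imp_null_set_lborel[OF S(1)]])
      then show "AE t in lborel. ennreal \<bar>h' t / ?L\<bar> * indicator {0..1} t
          \<le> ennreal (speed flat_torus \<gamma> t) * indicator {0..1} t"
      proof eventually_elim
        case (elim t)
        then have "\<bar>h' t / ?L\<bar> \<le> speed flat_torus \<gamma> t" if "t \<in> {0..1}"
        proof -
          have "\<bar>h' t\<bar> \<le> ?L * speed flat_torus \<gamma> t" using S(2) that elim by blast
          then show ?thesis
            unfolding abs_divide abs_of_pos[OF L] pos_divide_le_eq[OF L] by (subst mult.commute)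
        qed
        then show ?case by (auto split: split_indicator intro: ennreal_leI)
      qed
    qed
    finally show "ennreal (?\<Delta> / ?L) \<le> curve_length flat_torus \<gamma>" by (simp add: curve_length_def)
  qed
  then have "ennreal ?L * ennreal (?\<Delta> / ?L) \<le> ennreal ?L * geodesic_dist flat_torus p q"
    by (rule mult_left_mono) simp
  moreover have "ennreal ?L * ennreal (?\<Delta> / ?L) = ennreal ?\<Delta>"
    using L by (simp flip: ennreal_mult)
  moreover have "dist (torus_potential p *\<^sub>R e) (torus_potential q *\<^sub>R e) = ?\<Delta>"
    using assms by (simp add: dist_norm abs_minus_commute flip: scaleR_left_diff_distrib)
  ultimately show "ennreal (dist (torus_potential p *\<^sub>R e) (torus_potential q *\<^sub>R e))
      \<le> ennreal ?L * geodesic_dist flat_torus p q" by simp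
qed simp

section \<open>The torus as an instance of the linear problem\<close>

definition first_unit_vector :: ell2 where
  "first_unit_vector = Abs_ell2 (\<lambda>n. if n = 0 then 1 else 0)"

lemma norm_first_unit_vector: "norm first_unit_vector = 1"
proof -
  have sq: "(\<lambda>n. (if n = 0 then 1 else 0 :: real)\<^sup>2) = (\<lambda>n. if n = 0 then 1 else 0)" by auto
  have sums: "(\<lambda>n :: nat. if n = 0 then 1 else 0 :: real) sums 1"
    using sums_single[of 0 "\<lambda>_. 1 :: real"] by simp
  then have "ell2_nth first_unit_vector = (\<lambda>n. if n = 0 then 1 else 0)"
    unfolding first_unit_vector_def by (intro Abs_ell2_inverse) (simp add: sq sums_summable)
  then have "(norm first_unit_vector)\<^sup>2 = 1"
    unfolding norm_ell2_power2 using sums by (simp add: sq sums_unique[symmetric])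
  then show ?thesis by (simp add: power2_eq_1_iff) (use norm_ge_zero[of first_unit_vector] in linarith)
qed

lemma linear_problem_torus:
  "linear_problem (top_of_set torus) (torus_measure :: (complex ^ 'n::finite) measure)
    torus_potential (2 * real CARD('n)) first_unit_vector"
proof (intro linear_problem.intro linear_problem_axioms.intro)
  show "prob_space (torus_measure :: (complex ^ 'n) measure)"
    by (intro prob_spaceI emeasure_torus_measure_space)
  show "sets torus_measure = sets (borel_of (top_of_set (torus :: (complex ^ 'n) set)))"
    by (rule sets_torus_measure)
  show "continuous_map (top_of_set (torus :: (complex ^ 'n) set)) euclidean torus_potential"
    by (simp add: continuous_torus_potential)
qed (simp_all add: torus_potential_bounds norm_first_unit_vector)

section \<open>Scaling of the partition function\<close>

lemma cos_double_angle_bounds: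
  fixes a :: real
  assumes "\<bar>a\<bar> \<le> 1 / 2"
  shows "1 - cos (pi * a) \<le> (1 - cos (2 * pi * a)) / 2"
    and "(1 - cos (2 * pi * a)) / 4 \<le> 1 - cos (pi * a)"
    and "1 / 4 \<le> \<bar>a\<bar> \<Longrightarrow> 1 \<le> 1 - cos (2 * pi * a)"
proof -
  \<comment> \<open>\<open>?c\<close> lies between 0 and 1, so the factor \<open>1 + ?c\<close> of
    the double angle formula lies between 1 and 2; these two ends give the first two
    inequalities.\<close>
  let ?c = "cos (pi * a)"
  have eq: "1 - cos (2 * pi * a) = 2 * ((1 - ?c) * (1 + ?c))"
    using cos_double_cos[of "pi * a"] by (simp add: algebra_simps power2_eq_square)
  have "pi * \<bar>a\<bar> \<le> pi / 2" using assms by simp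
  then have "\<bar>pi * a\<bar> \<le> pi / 2" by (simp add: abs_mult)
  then have c: "0 \<le> ?c" unfolding abs_le_iff by (intro cos_ge_zero) linarith+
  have "(1 - ?c) * 1 \<le> (1 - ?c) * (1 + ?c)" using c by (intro mult_left_mono) auto
  then show "1 - ?c \<le> (1 - cos (2 * pi * a)) / 2" by (simp add: eq)
  have "(1 - ?c) * (1 + ?c) \<le> (1 - ?c) * 2" by (intro mult_left_mono) auto
  then show "(1 - cos (2 * pi * a)) / 4 \<le> 1 - ?c" by (simp add: eq)
  assume a: "1 / 4 \<le> \<bar>a\<bar>"
  have "cos (2 * pi * a) = cos (2 * pi * \<bar>a\<bar>)"
    using cos_abs_real[of "2 * pi * a"] by (simp add: abs_mult)
  also have "\<dots> \<le> cos (pi / 2)"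
    using a assms by (intro cos_monotone_0_pi_le) auto
  finally show "1 \<le> 1 - cos (2 * pi * a)" by simp
qed

lemma unit_cell_0_abs_le: "x \<in> unit_cell 0 \<Longrightarrow> \<bar>x $ i\<bar> \<le> 1 / 2"
  by (auto simp: unit_cell_def abs_le_iff) (smt (verit) field_sum_of_halves)+

lemma torus_energy_half:
  assumes "x \<in> unit_cell 0"
  shows "torus_energy ((1 / 2) *\<^sub>R x) \<le> torus_energy x / 2"
    and "torus_energy x / 4 \<le> torus_energy ((1 / 2) *\<^sub>R x)"
  unfolding torus_energy_eq sum_divide_distrib
  using cos_double_angle_bounds(1,2)[OF unit_cell_0_abs_le[OF assms]]
  by (auto intro!: sum_mono)

text \<open>Outside the half-size cell some coordinate has modulus at least \<open>1 / 4\<close>,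
  where the cosine is nonpositive. This energy gap makes the region exponentially negligible for
  large \<open>t\<close>.\<close>

lemma torus_energy_ge_1:
  assumes "x \<in> unit_cell 0" "2 *\<^sub>R x \<notin> unit_cell 0"
  shows "1 \<le> torus_energy x"
proof -
  obtain i where "\<not> (- 1 / 2 \<le> 2 * x $ i \<and> 2 * x $ i < 1 / 2)"
    using assms(2) by (auto simp: unit_cell_def)
  then have "1 / 4 \<le> \<bar>x $ i\<bar>" by auto
  then have "1 \<le> 1 - cos (2 * pi * x $ i)"
    using unit_cell_0_abs_le[OF assms(1)] by (intro cos_double_angle_bounds(3)) auto
  also have "\<dots> \<le> torus_energy x"
    unfolding torus_energy_eq by (intro member_le_sum) auto
  finally show ?thesis .
qed

lemma borel_measurable_torus_energy [measurable]: "torus_energy \<in> borel_measurable borel"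
  using torus_energy_has_derivative
  by (intro borel_measurable_continuous_onI has_derivative_continuous_on[of UNIV]) auto

lemma nn_integral_half:
  fixes f :: "real ^ 'n::finite \<Rightarrow> ennreal"
  assumes [measurable]: "f \<in> borel_measurable borel"
  shows "(\<integral>\<^sup>+x. f x \<partial>lborel) = ennreal ((1 / 2) ^ CARD('n)) * (\<integral>\<^sup>+x. f ((1 / 2) *\<^sub>R x) \<partial>lborel)"
proof -
  have "(\<integral>\<^sup>+x. f x \<partial>lborel) = (\<integral>\<^sup>+x. f x \<partial>density (distr lborel borel (\<lambda>x. 0 + (1 / 2) *\<^sub>R x)) (\<lambda>_. ennreal ((1 / 2) ^ CARD('n))))"
    using lborel_affine[of "1 / 2" "0 :: real ^ 'n"] by simp
  also have "\<dots> = ennreal ((1 / 2) ^ CARD('n)) * (\<integral>\<^sup>+x. f ((1 / 2) *\<^sub>R x) \<partial>lborel)"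
    by (simp add: nn_integral_density nn_integral_distr nn_integral_cmult)
  finally show ?thesis .
qed

text \<open>The partition function pulled back to the cell. The \<open>itself\<close> argument fixes
  the dimension, which \<open>t\<close> does not determine.\<close>

definition cell_integral :: "'n::finite itself \<Rightarrow> real \<Rightarrow> ennreal" where
  "cell_integral _ t =
    (\<integral>\<^sup>+x. ennreal (exp (- t * torus_energy x)) * indicator (unit_cell 0) (x :: real ^ 'n) \<partial>lborel)"

lemma partition_function_torus:
  "ennreal (linear_problem.partition_function (torus_measure :: (complex ^ 'n::finite) measure) torus_potential t)
    = cell_integral TYPE('n) t"
proof -
  interpret linear_problem "top_of_set torus" "torus_measure :: (complex ^ 'n) measure"
    torus_potential "2 * real CARD('n)" first_unit_vector
    by (rule linear_problem_torus)
  have "ennreal (partition_function t)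
      = (\<integral>\<^sup>+z. ennreal (exp (- t * torus_potential z)) \<partial>(torus_measure :: (complex ^ 'n) measure))"
    unfolding partition_function_def
    using integrable_exp_\<phi>[of "- t"] by (intro nn_integral_eq_integral[symmetric]) auto
  also have "\<dots> = cell_integral TYPE('n) t"
    unfolding cell_integral_def torus_energy_def
    using \<phi>_measurable_borel_of by (intro nn_integral_torus_measure) simp
  finally show ?thesis .
qed

lemma nn_integral_half_cell:
  fixes t :: real
  shows "(\<integral>\<^sup>+x. ennreal (exp (- t * torus_energy x)) * indicator (unit_cell 0) (2 *\<^sub>R (x :: real ^ 'n::finite)) \<partial>lborel)
    = ennreal ((1 / 2) ^ CARD('n)) *
      (\<integral>\<^sup>+x. ennreal (exp (- t * torus_energy ((1 / 2) *\<^sub>R x))) * indicator (unit_cell 0) (x :: real ^ 'n) \<partial>lborel)"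
  by (subst nn_integral_half) simp_all

lemma half_unit_cell_subset:
  assumes "2 *\<^sub>R x \<in> unit_cell 0" shows "x \<in> unit_cell 0"
proof -
  have "- (1 / 2) \<le> x $ i \<and> x $ i < 1 / 2" for i
  proof -
    have "- (1 / 2) \<le> 2 * x $ i \<and> 2 * x $ i < 1 / 2" using assms by (simp add: unit_cell_def)
    then show ?thesis by linarith
  qed
  then show ?thesis by (simp add: unit_cell_def)
qed

text \<open>Restrict the integral at \<open>t\<close> to the half-size cell and substitute
  \<open>x / 2\<close>: the Jacobian is the power of \<open>1 / 2\<close>, and halving the argument
  at least halves the energy.\<close>

lemma cell_integral_half:
  assumes "t > 0"
  shows "ennreal ((1 / 2) ^ CARD('n)) * cell_integral TYPE('n) (t / 2) \<le> cell_integral TYPE('n::finite) t"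
proof -
  have "ennreal ((1 / 2) ^ CARD('n)) * cell_integral TYPE('n) (t / 2)
      \<le> ennreal ((1 / 2) ^ CARD('n)) * (\<integral>\<^sup>+x. ennreal (exp (- t * torus_energy ((1 / 2) *\<^sub>R x))) *
        indicator (unit_cell 0) (x :: real ^ 'n) \<partial>lborel)"
    unfolding cell_integral_def
  proof (intro mult_left_mono nn_integral_mono)
    fix x :: "real ^ 'n"
    show "ennreal (exp (- (t / 2) * torus_energy x)) * indicator (unit_cell 0) x
        \<le> ennreal (exp (- t * torus_energy ((1 / 2) *\<^sub>R x))) * indicator (unit_cell 0) x"
      using mult_left_mono[OF torus_energy_half(1), of x t] assms
      by (auto split: split_indicator intro!: ennreal_leI)
  qed simp
  also have "\<dots> = (\<integral>\<^sup>+x. ennreal (exp (- t * torus_energy x)) *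
      indicator (unit_cell 0) (2 *\<^sub>R (x :: real ^ 'n)) \<partial>lborel)"
    by (rule nn_integral_half_cell[symmetric])
  also have "\<dots> \<le> cell_integral TYPE('n) t"
    unfolding cell_integral_def
    by (intro nn_integral_mono) (auto split: split_indicator dest: half_unit_cell_subset)
  finally show ?thesis .
qed

text \<open>The half-size cell contributes the power of \<open>1 / 2\<close>, because the energy at
  \<open>x / 2\<close> is at least a quarter of that at \<open>x\<close>. Outside it the energy is
  at least 1, so a factor \<open>exp (- 3 * t)\<close> can be split off.\<close>

lemma cell_integral_quadruple:
  assumes "t > 0"
  shows "cell_integral TYPE('n) (4 * t)
    \<le> ennreal ((1 / 2) ^ CARD('n) + exp (- 3 * t)) * cell_integral TYPE('n::finite) t"
proof -
  let ?f = "\<lambda>t (x :: real ^ 'n). ennreal (exp (- t * torus_energy x)) * indicator (unit_cell 0) x"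
  let ?g = "\<lambda>x :: real ^ 'n. ennreal (exp (- (4 * t) * torus_energy x)) * indicator (unit_cell 0) (2 *\<^sub>R x)"
  have "cell_integral TYPE('n) (4 * t) \<le> (\<integral>\<^sup>+x. ?g x + ennreal (exp (- 3 * t)) * ?f t x \<partial>lborel)"
    unfolding cell_integral_def
  proof (rule nn_integral_mono)
    fix x :: "real ^ 'n"
    show "?f (4 * t) x \<le> ?g x + ennreal (exp (- 3 * t)) * ?f t x"
    proof (cases "2 *\<^sub>R x \<in> unit_cell 0")
      case True
      then show ?thesis using half_unit_cell_subset[OF True] by (simp add: add_increasing2)
    next
      case False
      have "exp (- (4 * t) * torus_energy x) \<le> exp (- 3 * t) * exp (- t * torus_energy x)"
        if "x \<in> unit_cell 0"
      proof -
        have "3 * t * 1 \<le> 3 * t * torus_energy x"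
          using assms torus_energy_ge_1[OF that False] by (intro mult_left_mono) auto
        then show ?thesis by (simp flip: exp_add)
      qed
      then show ?thesis
        using False by (auto split: split_indicator intro!: ennreal_leI simp flip: ennreal_mult)
    qed
  qed
  also have "\<dots> = (\<integral>\<^sup>+x. ?g x \<partial>lborel) + ennreal (exp (- 3 * t)) * cell_integral TYPE('n) t"
    unfolding cell_integral_def by (subst nn_integral_add) (simp_all add: nn_integral_cmult)
  also have "(\<integral>\<^sup>+x. ?g x \<partial>lborel) \<le> ennreal ((1 / 2) ^ CARD('n)) * cell_integral TYPE('n) t"
    unfolding nn_integral_half_cell cell_integral_def
  proof (intro mult_left_mono nn_integral_mono)
    fix x :: "real ^ 'n"
    show "ennreal (exp (- (4 * t) * torus_energy ((1 / 2) *\<^sub>R x))) * indicator (unit_cell 0) x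
        \<le> ?f t x"
      using mult_left_mono[OF torus_energy_half(2), of x "4 * t"] assms
      by (auto split: split_indicator intro!: ennreal_leI)
  qed simp
  finally show ?thesis by (simp add: ennreal_plus distrib_right)
qed

lemma partition_function_torus_half:
  defines "Z \<equiv> linear_problem.partition_function (torus_measure :: (complex ^ 'n::finite) measure) torus_potential"
  assumes "t > 0"
  shows "Z (t / 2) \<le> 2 ^ CARD('n) * Z t"
proof -
  interpret linear_problem "top_of_set torus" "torus_measure :: (complex ^ 'n) measure"
    torus_potential "2 * real CARD('n)" first_unit_vector
    by (rule linear_problem_torus)
  have Z: "0 < Z t" for t unfolding Z_def by (rule partition_pos)
  have "ennreal ((1 / 2) ^ CARD('n)) * ennreal (Z (t / 2)) \<le> ennreal (Z t)"
    unfolding Z_def partition_function_torus by (rule cell_integral_half[OF assms(2)])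
  then have "(1 / 2) ^ CARD('n) * Z (t / 2) \<le> Z t"
    using Z[of t] Z[of "t / 2"] by (simp flip: ennreal_mult)
  then show ?thesis by (simp add: power_one_over field_simps)
qed

lemma partition_function_torus_quadruple:
  defines "Z \<equiv> linear_problem.partition_function (torus_measure :: (complex ^ 'n::finite) measure) torus_potential"
  assumes "t \<ge> 1"
  shows "Z (4 * t) \<le> 3 / 4 * Z t"
proof -
  interpret linear_problem "top_of_set torus" "torus_measure :: (complex ^ 'n) measure"
    torus_potential "2 * real CARD('n)" first_unit_vector
    by (rule linear_problem_torus)
  have Z: "0 < Z t" for t unfolding Z_def by (rule partition_pos)
  have "ennreal (Z (4 * t)) \<le> ennreal ((1 / 2) ^ CARD('n) + exp (- 3 * t)) * ennreal (Z t)"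
    unfolding Z_def partition_function_torus using assms(2) by (intro cell_integral_quadruple) simp
  then have "Z (4 * t) \<le> ((1 / 2) ^ CARD('n) + exp (- 3 * t)) * Z t"
    using Z[of t] Z[of "4 * t"] by (simp del: ennreal_plus flip: ennreal_mult)
  also have "\<dots> \<le> 3 / 4 * Z t"
  proof (rule mult_right_mono)
    \<comment> \<open>The dimension is at least 1, so the Jacobian is at most \<open>1 / 2\<close>;
      the outer region adds at most \<open>1 / 4\<close> because
      \<open>1 + 3 * t \<ge> 4\<close>.\<close>
    have "(1 / 2 :: real) ^ CARD('n) \<le> (1 / 2) ^ 1"
      by (rule power_decreasing) (simp_all add: Suc_leI)
    moreover have "4 \<le> exp (3 * t)" using exp_ge_add_one_self[of "3 * t"] assms(2) by linarith
    then have "exp (- 3 * t) \<le> 1 / 4" by (simp add: exp_minus field_simps)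
    ultimately show "(1 / 2) ^ CARD('n) + exp (- 3 * t) \<le> 3 / 4" by simp
  qed (use Z[of t] in simp)
  finally show ?thesis .
qed

theorem proposition5p5:
  assumes "setting \<in> {setting_I, setting_II}"
  shows "\<exists>(M :: (complex ^ 'n, 'n::finite) riemannian) \<nu> \<tau> (P :: (complex ^ 'n, ell2) objective).
    compact_riemannian_manifold M \<and> riemannian_volume M \<nu> \<and> \<tau> = normalized \<nu> \<and>
    assumption_A1 M P \<and> setting M \<tau> P \<and>
    (\<forall>s>0.
       (\<exists>f. pgm_iterates (topol M) \<tau> P entropy entropy_deriv s (\<lambda>_. 1) f) \<and>
       (\<forall>f. pgm_iterates (topol M) \<tau> P entropy entropy_deriv s (\<lambda>_. 1) f \<longrightarrow>
          (\<exists>c>0. \<exists>C>0. \<forall>k\<ge>1.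
             ereal (c / real k) \<le> F_dens (topol M) \<tau> P (f k) - inf_F (topol M) \<tau> P \<and>
             F_dens (topol M) \<tau> P (f k) - inf_F (topol M) \<tau> P \<le> ereal (C / real k))))"
proof -
  interpret linear_problem "top_of_set torus" "torus_measure :: (complex ^ 'n) measure"
    torus_potential "2 * real CARD('n)" first_unit_vector
    by (rule linear_problem_torus)
  let ?M = "flat_torus :: (complex ^ 'n, 'n) riemannian"
  have X: "topol ?M = top_of_set torus" by (simp add: flat_torus_def)
  note doubling = partition_function_torus_half[where 'n = 'n] partition_function_torus_quadruple[where 'n = 'n]
  have "torus_potential (torus_map 0 :: complex ^ 'n) = 0"
    by (simp add: torus_potential_def torus_map_def)
  then have "has_minimizer (topol ?M) torus_measure problem"
    unfolding X using inf_F_problem[OF doubling]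
    by (intro has_minimizer_problem[of "torus_map 0"]) (simp_all add: torus_def)
  moreover have "feature problem = (\<lambda>z. torus_potential z *\<^sub>R first_unit_vector)"
    by (simp add: problem_def)
  \<comment> \<open>The same objective satisfies both settings, so either value of
    \<open>setting\<close> is covered.\<close>
  ultimately have "setting ?M torus_measure problem"
    using assms lipschitz_torus_potential[OF norm_first_unit_vector] lipschitz_derivative_torus_potential
    by (auto simp: setting_I_def setting_II_def)
  then show ?thesis
    using compact_riemannian_manifold_flat_torus riemannian_volume_torus_measure
      normalized_torus_measure[symmetric] assumption_A1_problem[OF X]
      pgm_iterates_gibbs pgm_rate[OF doubling]
    by (intro exI[of _ ?M] exI[of _ torus_measure] exI[of _ problem]) (auto simp: X)
qed

end
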